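(* Let $Z$ be a compact abelian group with Haar probability measure $\mu$ and let $d\ge1$ be an integer. The Banach space $A(d)$ is invariant under pointwise multiplication and $\|\cdot\|_{A(d)}$ is an algebra norm, meaning that for all $g,g'\in A(d)$, $$\|gg'\|_{A(d)}\le\|g\|_{A(d)}\,\|g'\|_{A(d)} .$$
   Context: All functions are real valued and measurable; $\|\cdot\|_p$ is the $L^p(\mu)$ norm; $\mathbb E$ denotes the integral with respect to $\mu$ (or a product of copies of $\mu$). $V_d=\{0,1\}^d$, $\widetilde V_d=V_d\setminus\{\vec0\}$, and $\vec\epsilon\cdot\vec t=\epsilon_1t_1+\dots+\epsilon_dt_d$ for $\vec\epsilon\in V_d$, $\vec t\in Z^d$. Cubic convolution product: for functions $f_{\vec\epsilon}\in L^{2^{d-1}}(\mu)$, $\vec\epsilon\in\widetilde V_d$, $\mathcal D_d(f_{\vec\epsilon}\colon\vec\epsilon\in\widetilde V_d)(x)=\mathbb E_{\vec t\in Z^d}\prod_{\vec\epsilon\in\widetilde V_d}f_{\vec\epsilon}(x+\vec\epsilon\cdot\vec t)$ (the integral converges absolutely for every $x$). $A(d)$ is the space of functions $g$ on $Z$ that can be written as $g(x)=\sum_{j=1}^\infty\mathcal D_d(f_{j,\vec\epsilon}\colon\vec\epsilon\in\widetilde V_d)(x)$ with all $f_{j,\vec\epsilon}\in L^{2^{d-1}}(\mu)$ and $\sum_{j=1}^\infty\prod_{\vec\epsilon\in\widetilde V_d}\|f_{j,\vec\epsilon}\|_{2^{d-1}}<+\infty$; $\|g\|_{A(d)}$ is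 the infimum of $\sum_{j}\prod_{\vec\epsilon\in\widetilde V_d}\|f_{j,\vec\epsilon}\|_{2^{d-1}}$ over all such representations. With this norm $A(d)$ is a Banach space of continuous functions on $Z$. *)

theory Defs
  imports "HOL-Probability.Probability"
begin

text \<open>
  No countability assumption is made on the group, so regularity of the Haar measure has to be
  demanded explicitly: outside the metrizable case it does not follow from the other conditions.
\<close>

definition haar_probability :: "'a::topological_ab_group_add measure \<Rightarrow> bool" where
  "haar_probability M \<longleftrightarrow>
     prob_space M \<and> sets M = sets borel \<and>
     (\<forall>a. distr M borel (\<lambda>x. a + x) = M) \<and>
     (\<forall>B\<in>sets M. emeasure M B = (SUP K\<in>{K. K \<subseteq> B \<and> compact K}. emeasure M K))"

text \<open>
  Functions are not identified when they agree almost everywhere; \<open>Lnorm\<close> is only meaningful on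
  members of \<open>Lspace\<close> with the same exponent.
\<close>

definition Lspace :: "real \<Rightarrow> 'a measure \<Rightarrow> ('a \<Rightarrow> real) set" where
  "Lspace p M = {f \<in> borel_measurable M. integrable M (\<lambda>x. \<bar>f x\<bar> powr p)}"

definition Lnorm :: "real \<Rightarrow> 'a measure \<Rightarrow> ('a \<Rightarrow> real) \<Rightarrow> real" where
  "Lnorm p M f = (\<integral>x. \<bar>f x\<bar> powr p \<partial>M) powr (1 / p)"

definition cube :: "nat \<Rightarrow> (nat \<Rightarrow> nat) set" where
  "cube d = {..<d} \<rightarrow>\<^sub>E {0, 1}"

definition cube_nz :: "nat \<Rightarrow> (nat \<Rightarrow> nat) set" where
  "cube_nz d = cube d - {\<lambda>i\<in>{..<d}. 0}"

definition cube_dot :: "nat \<Rightarrow> (nat \<Rightarrow> nat) \<Rightarrow> (nat \<Rightarrow> 'a::comm_monoid_add) \<Rightarrow> 'a" where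
  "cube_dot d e t = (\<Sum>i<d. if e i = 1 then t i else 0)"

text \<open>
  The product of \<open>d\<close> copies of \<open>M\<close> is completed because, without second countability, a function
  such as \<open>\<lambda>t. f (x + t 0 + t 1)\<close> with \<open>f\<close> Borel need not be measurable for the product of the
  Borel sigma-algebras. It is measurable for the completion: Haar measure is completion regular
  (Kakutani--Kodaira), so \<open>f\<close> coincides with a Baire function outside a Baire null set.
  For second countable groups the completion does not change the integral.
\<close>

definition cubic_conv ::
  "'a::topological_ab_group_add measure \<Rightarrow> nat \<Rightarrow> ((nat \<Rightarrow> nat) \<Rightarrow> 'a \<Rightarrow> real) \<Rightarrow> 'a \<Rightarrow> real" where
  "cubic_conv M d f x =
     (\<integral>t. (\<Prod>e\<in>cube_nz d. f e (x + cube_dot d e t)) \<partial>completion (PiM {..<d} (\<lambda>_. M)))"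

definition A_weight ::
  "'a measure \<Rightarrow> nat \<Rightarrow> ((nat \<Rightarrow> nat) \<Rightarrow> 'a \<Rightarrow> real) \<Rightarrow> real" where
  "A_weight M d f = (\<Prod>e\<in>cube_nz d. Lnorm (2 ^ (d - 1)) M (f e))"

definition A_rep ::
  "'a::topological_ab_group_add measure \<Rightarrow> nat \<Rightarrow> ('a \<Rightarrow> real) \<Rightarrow>
   (nat \<Rightarrow> (nat \<Rightarrow> nat) \<Rightarrow> 'a \<Rightarrow> real) \<Rightarrow> bool" where
  "A_rep M d g f \<longleftrightarrow>
     (\<forall>j. \<forall>e\<in>cube_nz d. f j e \<in> Lspace (2 ^ (d - 1)) M) \<and>
     summable (\<lambda>j. A_weight M d (f j)) \<and>
     (\<forall>x. (\<lambda>j. cubic_conv M d (f j) x) sums g x)"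

definition A_space ::
  "'a::topological_ab_group_add measure \<Rightarrow> nat \<Rightarrow> ('a \<Rightarrow> real) set" where
  "A_space M d = {g. \<exists>f. A_rep M d g f}"

definition A_norm ::
  "'a::topological_ab_group_add measure \<Rightarrow> nat \<Rightarrow> ('a \<Rightarrow> real) \<Rightarrow> real" where
  "A_norm M d g = (INF f\<in>{f. A_rep M d g f}. \<Sum>j. A_weight M d (f j))"

end

theory Submission
  imports Defs
begin

text \<open>
  Substituting \<open>s + t\<close> for the second variable in \<open>g(x) g'(x)\<close>, where \<open>g\<close> and \<open>g'\<close> are the cubic
  convolution products of \<open>f\<close> and \<open>f'\<close>, shows that \<open>g g'\<close> is the mean over \<open>t\<close> of the cubic convolution
  products of the tuples \<open>f\<^sub>\<epsilon> f'\<^sub>\<epsilon>(\<cdot> + \<epsilon> \<cdot> t)\<close>. The product of their norms is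
  \<open>\<Prod>\<^sub>\<epsilon> h\<^sub>\<epsilon>(\<epsilon> \<cdot> t)\<close> with \<open>h\<^sub>\<epsilon>(s) = \<parallel>f\<^sub>\<epsilon> f'\<^sub>\<epsilon>(\<cdot> + s)\<parallel>\<close>. Integrating one coordinate of \<open>t\<close> at a time and
  applying Hoelder's inequality to the at most \<open>2^(d-1)\<close> factors with that top coordinate bounds the
  mean of this by \<open>\<Prod>\<^sub>\<epsilon> \<parallel>h\<^sub>\<epsilon>\<parallel> = \<Prod>\<^sub>\<epsilon> \<parallel>f\<^sub>\<epsilon>\<parallel> \<parallel>f'\<^sub>\<epsilon>\<parallel>\<close>. For continuous tuples the mean is a limit of
  finite averages, and telescoping the limit turns it into a countable sum. Approximation in the norm
  reduces the general case to continuous tuples.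
\<close>

section \<open>Cubes\<close>

text \<open>Two obstacles shape the proof. The group need not be second countable, so the Borel sets
  of a power of the group can exceed the product sigma-algebra, and addition may fail to be
  measurable for it. Compactness is the substitute: translates of finitely many continuous functions
  are uniformly close to translates by finitely many points. For entries that are not continuous,
  the preimage of a Borel null set under a vertex sum may fail to be measurable, so null sets are
  enclosed in cozero sets of small measure. The second obstacle is that a member of
  \<open>A_space\<close> must be represented at every point with summable weights, so pointwise
  approximation is not enough: consecutive approximations have to differ by functions of small norm.
  Cubic convolution is multilinear, hence exchanging the entries one vertex at a time bounds these
  differences by distances between the entries, and a geometric rate makes their total as small as
  desired.\<close>

lemma cube_dot_Suc: "cube_dot (Suc d) e t = cube_dot d e t + (if e d = 1 then t d else 0)"
  by (simp add: cube_dot_def)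

lemma cube_dot_add:
  "cube_dot d e (\<lambda>i. s i + t i) = cube_dot d e s + cube_dot d e t"
  unfolding cube_dot_def by (subst sum.distrib[symmetric]) (auto intro!: sum.cong)

lemma cube_dot_cong: "(\<And>i. i < d \<Longrightarrow> s i = t i) \<Longrightarrow> cube_dot d e s = cube_dot d e t"
  unfolding cube_dot_def by (rule sum.cong) auto

text \<open>The coordinates are exchanged one after another. Since the hypothesis is uniform in
  \<open>y\<close>, the other summands are absorbed into the base point, and each exchange costs at
  most \<delta>.\<close>

lemma cube_dot_approx:
  fixes f :: "'a::comm_monoid_add \<Rightarrow> real"
  assumes "\<And>t y. \<bar>f (y + t) - f (y + \<tau> t)\<bar> \<le> \<delta>"
  shows "\<bar>f (x + cube_dot d e t) - f (x + cube_dot d e (\<lambda>i. \<tau> (t i)))\<bar> \<le> d * \<delta>"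
proof (induction d arbitrary: x)
  case 0
  then show ?case by (simp add: cube_dot_def)
next
  case (Suc d)
  have \<delta>: "\<delta> \<ge> 0"
    using assms[of 0 0] by linarith
  show ?case
  proof (cases "e d = 1")
    case True
    have "\<bar>f (x + t d + cube_dot d e t) - f (x + t d + cube_dot d e (\<lambda>i. \<tau> (t i)))\<bar> \<le> d * \<delta>"
      by (rule Suc)
    moreover have "\<bar>f ((x + cube_dot d e (\<lambda>i. \<tau> (t i))) + t d) - f ((x + cube_dot d e (\<lambda>i. \<tau> (t i))) + \<tau> (t d))\<bar> \<le> \<delta>"
      by (rule assms)
    ultimately show ?thesis
      using True by (simp add: cube_dot_Suc ac_simps distrib_left)
  next
    case False
    then show ?thesis
      using Suc[of x] \<delta> by (simp add: cube_dot_Suc distrib_right)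
  qed
qed

lemma cube_nz_coordinate:
  assumes "e \<in> cube_nz d"
  obtains i where "i < d" "e i = 1"
proof -
  have "\<exists>i<d. e i = 1"
  proof (rule ccontr)
    assume "\<not> ?thesis"
    then have "e = (\<lambda>i\<in>{..<d}. 0)"
      using assms by (fastforce simp: cube_nz_def cube_def PiE_iff extensional_def fun_eq_iff)
    with assms show False
      by (simp add: cube_nz_def)
  qed
  with that show thesis by blast
qed

text \<open>With the other coordinates fixed, the vertex sum is a translate of the single coordinate
  \<open>i\<close>, the form in which invariance of the Haar measure applies.\<close>

lemma cube_dot_update:
  fixes t :: "nat \<Rightarrow> 'a::comm_monoid_add"
  assumes "i < d" "e i = 1"
  shows "cube_dot d e (t(i := y)) = (\<Sum>j\<in>{..<d} - {i}. if e j = 1 then t j else 0) + y"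
proof -
  have "cube_dot d e (t(i := y)) = y + (\<Sum>j\<in>{..<d} - {i}. if e j = 1 then (t(i := y)) j else 0)"
    unfolding cube_dot_def using assms by (subst sum.remove[of _ i]) auto
  also have "(\<Sum>j\<in>{..<d} - {i}. if e j = 1 then (t(i := y)) j else 0) = (\<Sum>j\<in>{..<d} - {i}. if e j = 1 then t j else 0)"
    by (rule sum.cong) auto
  finally show ?thesis
    by (simp only: add.commute)
qed

lemma LIMSEQ_abs_le:
  fixes a :: "nat \<Rightarrow> real"
  assumes "\<And>n. \<bar>L - a n\<bar> \<le> C * (1 / 2) ^ n"
  shows "a \<longlonglongrightarrow> L"
proof (rule LIM_zero_cancel, rule Lim_null_comparison)
  show "\<forall>\<^sub>F n in sequentially. norm (a n - L) \<le> C * (1 / 2) ^ n"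
    using assms by (auto simp: abs_minus_commute)
  show "(\<lambda>n. C * (1 / 2) ^ n) \<longlonglongrightarrow> 0"
    by (intro tendsto_mult_right_zero LIMSEQ_power_zero) auto
qed

lemma finite_cube_nz [simp]: "finite (cube_nz d)"
  by (auto simp: cube_nz_def cube_def intro: finite_PiE)

text \<open>The induction parameter for integrating one coordinate at a time: the set grows from
  empty at \<open>k = 0\<close> to \<open>cube_nz d\<close> at \<open>k = d\<close>. Its vertices
  keep all \<open>d\<close> coordinates, so families indexed by \<open>cube_nz d\<close> need no
  reindexing.\<close>

definition subcube :: "nat \<Rightarrow> nat \<Rightarrow> (nat \<Rightarrow> nat) set" where
  "subcube d k = {e \<in> cube_nz d. \<forall>i. k \<le> i \<longrightarrow> i < d \<longrightarrow> e i = 0}"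

text \<open>A vertex whose last nonzero coordinate is \<open>k\<close> is determined by its first
  \<open>k\<close> coordinates, which leaves at most \<open>2 ^ k\<close> of them. The coarser bound
  is independent of \<open>k\<close>, so one exponent serves in every integration.\<close>

lemma card_subcube_top:
  assumes "k < d"
  shows "card {e \<in> subcube d (Suc k). e k = 1} \<le> 2 ^ (d - 1)"
proof -
  let ?T = "{e \<in> subcube d (Suc k). e k = 1}"
  have inj: "inj_on (\<lambda>e. restrict e {..<k}) ?T"
  proof (rule inj_onI, rule ext)
    fix e e' i assume e: "e \<in> ?T" "e' \<in> ?T" "restrict e {..<k} = restrict e' {..<k}"
    consider "i < k" | "i = k" | "k < i" "i < d" | "d \<le> i"
      by linarith
    then show "e i = e' i"
    proof cases
      case 1
      then show ?thesis
        using fun_cong[OF e(3), of i] by simp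
    qed (use e in \<open>auto simp: subcube_def cube_nz_def cube_def PiE_iff extensional_def\<close>)
  qed
  have "(\<lambda>e. restrict e {..<k}) ` ?T \<subseteq> {..<k} \<rightarrow>\<^sub>E {0, 1::nat}"
  proof
    fix r assume "r \<in> (\<lambda>e. restrict e {..<k}) ` ?T"
    then obtain e where e: "e \<in> cube d" "r = restrict e {..<k}"
      by (auto simp: subcube_def cube_nz_def)
    then have "e i \<in> {0, 1}" if "i < k" for i
      using that assms PiE_mem[of e "{..<d}" "\<lambda>_. {0, 1}" i] by (simp add: cube_def)
    then show "r \<in> {..<k} \<rightarrow>\<^sub>E {0, 1::nat}"
      using e(2) by auto
  qed
  then have "card ?T \<le> card ({..<k} \<rightarrow>\<^sub>E {0, 1::nat})"
    by (intro card_inj_on_le[OF inj]) (auto intro: finite_PiE)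
  also have "\<dots> = 2 ^ k"
    by (simp add: card_PiE numeral_2_eq_2)
  also have "\<dots> \<le> 2 ^ (d - 1)"
    using assms by (intro power_increasing) auto
  finally show ?thesis .
qed

section \<open>Finitely valued translations on a compact group\<close>

locale compact_haar_group = prob_space M
  for M :: "'a::{topological_ab_group_add, t2_space} measure" +
  assumes compact_UNIV: "compact (UNIV :: 'a set)"
    and haar: "haar_probability M"
begin

lemma sets_M [measurable_cong, simp]: "sets M = sets borel"
  using haar by (simp add: haar_probability_def)

lemma space_M [simp]: "space M = UNIV"
  using sets_eq_imp_space_eq[OF sets_M] by simp

lemma continuous_measurable: "continuous_on UNIV f \<Longrightarrow> f \<in> borel_measurable M" 
  for f :: "'a \<Rightarrow> real"
  using borel_measurable_continuous_onI measurable_cong_sets[OF sets_M refl] by blast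

lemma translate_measurable [measurable]: "(\<lambda>x. a + x) \<in> M \<rightarrow>\<^sub>M M"
  by (simp add: measurable_cong_sets[OF sets_M sets_M] borel_measurable_continuous_onI continuous_intros)

lemma distr_translate: "distr M M (\<lambda>x. a + x) = M"
  using haar distr_cong[OF refl sets_M, of M "\<lambda>x. a + x" "\<lambda>x. a + x"]
  by (simp add: haar_probability_def)

lemma emeasure_translate:
  assumes "A \<in> sets M"
  shows "emeasure M {x. a + x \<in> A} = emeasure M A"
  using emeasure_distr[OF translate_measurable assms, of a] by (simp add: distr_translate vimage_def)

lemma inner_regular:
  assumes "B \<in> sets M" "e > 0"
  obtains K where "compact K" "K \<subseteq> B" "measure M B < measure M K + e"
proof -
  have eq: "emeasure M B = (SUP K\<in>{K. K \<subseteq> B \<and> compact K}. emeasure M K)"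
    using haar assms by (simp add: haar_probability_def)
  have "\<exists>K\<in>{K. K \<subseteq> B \<and> compact K}. measure M B < measure M K + e"
  \<comment> \<open>\<open>ennreal\<close> sends negative numbers to 0, so the case of a negative
    threshold \<open>measure M B - e\<close> is settled separately by the empty set.\<close>
  proof (cases "measure M B < e")
    case True
    then show ?thesis
      by (intro bexI[of _ "{}"]) auto
  next
    case False
    have "ennreal (measure M B - e) < ennreal (measure M B)"
      using False assms by (intro ennreal_lessI) auto
    also have "\<dots> = (SUP K\<in>{K. K \<subseteq> B \<and> compact K}. emeasure M K)"
      using eq by (simp add: emeasure_eq_measure)
    finally obtain K where "K \<in> {K. K \<subseteq> B \<and> compact K}" "ennreal (measure M B - e) < emeasure M K"
      by (auto simp: less_SUP_iff)
    then show ?thesis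
      using False by (intro bexI[of _ K]) (auto simp: emeasure_eq_measure ennreal_less_iff)
  qed
  then show thesis
    using that by blast
qed

text \<open>The open set of pairs \<open>?W\<close> contains the slice over \<open>t\<close>; the
  tube lemma turns compactness of the group into a neighbourhood of \<open>t\<close> that works for
  all \<open>y\<close>. Hence translation is continuous for the supremum norm.\<close>

lemma uniform_translate:
  fixes f :: "'a \<Rightarrow> real"
  assumes f: "continuous_on UNIV f" and e: "0 < e"
  shows "\<exists>U. open U \<and> t \<in> U \<and> (\<forall>s\<in>U. \<forall>y. \<bar>f (y + s) - f (y + t)\<bar> < e)"
proof -
  let ?W = "{p :: 'a \<times> 'a. \<bar>f (fst p + snd p) - f (fst p + t)\<bar> < e}"
  have "open ?W"
    by (intro open_Collect_less continuous_intros continuous_on_compose2[OF f]) auto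
  then have "\<exists>U V. openin euclidean U \<and> openin euclidean V \<and> UNIV \<subseteq> U \<and> t \<in> V \<and> U \<times> V \<subseteq> ?W"
    using compact_UNIV e by (intro tube_lemma_left) auto
  then obtain U V where "open V" "UNIV \<subseteq> U" "t \<in> V" "U \<times> V \<subseteq> ?W"
    by auto
  then show ?thesis
    by (intro exI[of _ V]) (auto simp: subset_iff)
qed

lemma continuous_bounded:
  fixes f :: "'a \<Rightarrow> real"
  assumes "continuous_on UNIV f"
  obtains C where "C > 0" "\<And>x. \<bar>f x\<bar> \<le> C"
proof -
  have "bounded (range f)"
    using compact_continuous_image[OF assms compact_UNIV] compact_imp_bounded by blast
  then show thesis
    using that by (auto simp: bounded_pos)
qed

text \<open>The covering sets may overlap, so a nested case distinction assigns one index to each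
  point; openness makes the cases measurable. Outside the union the value is arbitrary.\<close>

lemma simple_selection:
  assumes "finite D" "\<And>t. open (V t)"
  shows "\<exists>\<tau>. simple_function M \<tau> \<and> (\<forall>t\<in>(\<Union>d\<in>D. V d). t \<in> V (\<tau> t))"
  using assms(1)
proof induction
  case empty
  then show ?case
    by (auto intro!: exI[of _ "\<lambda>_. undefined"])
next
  case (insert d D)
  then obtain \<tau> where \<tau>: "simple_function M \<tau>" "\<forall>t\<in>(\<Union>d\<in>D. V d). t \<in> V (\<tau> t)"
    by blast
  have "simple_function M (\<lambda>t. if t \<in> V d then d else \<tau> t)"
    using \<tau>(1) assms(2) by (intro simple_function_If simple_function_const) auto
  then show ?case
    using \<tau>(2) by (intro exI[of _ "\<lambda>t. if t \<in> V d then d else \<tau> t"]) auto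
qed

text \<open>Without second countability, measurability on product spaces of \<open>\<lambda>(s, t). f (s + t)\<close>,
  and every interchange of integrals, is reduced to finitely many translations by means of these
  simple functions \<open>\<tau>\<close>.\<close>

lemma simple_translate_approx:
  fixes H :: "('a \<Rightarrow> real) set"
  assumes H: "finite H" "\<And>f. f \<in> H \<Longrightarrow> continuous_on UNIV f" and e: "0 < e"
  shows "\<exists>\<tau>. simple_function M \<tau> \<and> (\<forall>f\<in>H. \<forall>t y. \<bar>f (y + t) - f (y + \<tau> t)\<bar> \<le> e)"
proof -
  have "\<forall>f\<in>H. \<forall>t. \<exists>U. open U \<and> t \<in> U \<and> (\<forall>s\<in>U. \<forall>y. \<bar>f (y + s) - f (y + t)\<bar> < e)"
    using uniform_translate[OF H(2) e] by blast
  then obtain U where U: "\<And>f t. f \<in> H \<Longrightarrow> open (U f t) \<and> t \<in> U f t \<and>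
      (\<forall>s\<in>U f t. \<forall>y. \<bar>f (y + s) - f (y + t)\<bar> < e)"
    by metis
  \<comment> \<open>One neighbourhood for all functions of \<open>H\<close> at once; finiteness of
    \<open>H\<close> keeps it open.\<close>
  define V where "V t = (\<Inter>f\<in>H. U f t)" for t
  have V: "open (V t)" "t \<in> V t" for t
    using U H(1) by (auto simp: V_def)
  obtain D where "D \<subseteq> UNIV" "finite D" and D: "UNIV \<subseteq> (\<Union>d\<in>D. V d)"
    using compactE_image[OF compact_UNIV, of UNIV V] V by blast
  then obtain \<tau> where \<tau>: "simple_function M \<tau>" "\<forall>t\<in>(\<Union>d\<in>D. V d). t \<in> V (\<tau> t)"
    using simple_selection[of D V] V by blast
  have "\<bar>f (y + t) - f (y + \<tau> t)\<bar> < e" if "f \<in> H" for f t y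
    using \<tau>(2) D U[OF that, of "\<tau> t"] that unfolding V_def by blast
  with \<tau>(1) show ?thesis
    by (intro exI[of _ \<tau>]) (auto intro: less_imp_le)
qed

lemma simple_translate_sequence:
  fixes H :: "('a \<Rightarrow> real) set"
  assumes H: "finite H" "\<And>f. f \<in> H \<Longrightarrow> continuous_on UNIV f" and e: "\<And>n::nat. 0 < e n"
  obtains \<tau> where "\<And>n. simple_function M (\<tau> n)"
    "\<And>n f t y. f \<in> H \<Longrightarrow> \<bar>f (y + t) - f (y + \<tau> n t)\<bar> \<le> e n"
  using simple_translate_approx[OF H e] by metis

lemma simple_cube_dot:
  assumes "simple_function M \<tau>"
  shows "simple_function (PiM {..<d} (\<lambda>_. M)) (\<lambda>t. cube_dot d e (\<lambda>i. \<tau> (t i)))"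
  unfolding cube_dot_def
proof (rule simple_function_sum)
  fix i assume i: "i \<in> {..<d}"
  have "simple_function (PiM {..<d} (\<lambda>_. M)) (\<lambda>t. \<tau> (t i))"
    by (rule simple_function_comp[OF _ assms]) (use i in measurable)
  then show "simple_function (PiM {..<d} (\<lambda>_. M)) (\<lambda>t. if e i = 1 then \<tau> (t i) else 0)"
    by (cases "e i = 1") auto
qed

text \<open>Rounding every coordinate of \<open>t\<close> by \<open>\<tau> n\<close> turns the
  vertex sum into a simple function for the product sigma-algebra, and continuity of
  \<open>f\<close> makes the rounded values converge uniformly to the given ones.\<close>

lemma cube_dot_measurable:
  fixes f :: "'a \<Rightarrow> real"
  assumes f: "continuous_on UNIV f"
  shows "(\<lambda>t. f (x + cube_dot d e t)) \<in> borel_measurable (PiM {..<d} (\<lambda>_. M))"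
proof -
  obtain \<tau> where \<tau>: "\<And>n. simple_function M (\<tau> n)"
    "\<And>n g t y. g \<in> {f} \<Longrightarrow> \<bar>g (y + t) - g (y + \<tau> n t)\<bar> \<le> (1 / 2) ^ n"
    using simple_translate_sequence[of "{f}" "\<lambda>n. (1 / 2) ^ n"] f by auto
  show ?thesis
  proof (rule borel_measurable_LIMSEQ_real)
    show "(\<lambda>n. f (x + cube_dot d e (\<lambda>i. \<tau> n (t i)))) \<longlonglongrightarrow> f (x + cube_dot d e t)" for t
      by (rule LIMSEQ_abs_le[of _ _ d], rule cube_dot_approx) (use \<tau>(2) in auto)
    show "(\<lambda>t. f (x + cube_dot d e (\<lambda>i. \<tau> n (t i)))) \<in> borel_measurable (PiM {..<d} (\<lambda>_. M))" for n
      by (intro borel_measurable_simple_function simple_function_compose1[OF simple_cube_dot] \<tau>)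
  qed
qed

text \<open>Only the shift \<open>s\<close> is rounded: on each of the finitely many level sets of
  \<open>\<tau> n\<close> the function is a fixed translate of \<open>f\<close> in the variable
  \<open>y\<close>, and measurability passes to the limit.\<close>

lemma plus_measurable_pair:
  fixes f :: "'a \<Rightarrow> real"
  assumes f: "continuous_on UNIV f"
  shows "(\<lambda>(s, y). f (y + s)) \<in> borel_measurable (M \<Otimes>\<^sub>M M)"
proof -
  obtain \<tau> where \<tau>: "\<And>n. simple_function M (\<tau> n)"
    "\<And>n g t y. g \<in> {f} \<Longrightarrow> \<bar>g (y + t) - g (y + \<tau> n t)\<bar> \<le> (1 / 2) ^ n"
    using simple_translate_sequence[of "{f}" "\<lambda>n. (1 / 2) ^ n"] f by auto
  show ?thesis
  proof (rule borel_measurable_LIMSEQ_real)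
    show "(\<lambda>n. case p of (s, y) \<Rightarrow> f (y + \<tau> n s)) \<longlonglongrightarrow> (case p of (s, y) \<Rightarrow> f (y + s))" for p
      using LIMSEQ_abs_le[of "f (snd p + fst p)" "\<lambda>n. f (snd p + \<tau> n (fst p))" 1] \<tau>(2)
      by (auto simp: case_prod_beta)
    show "(\<lambda>p. case p of (s, y) \<Rightarrow> f (y + \<tau> n s)) \<in> borel_measurable (M \<Otimes>\<^sub>M M)" for n
    proof -
      have [measurable]: "f \<in> borel_measurable M"
        using f by (rule continuous_measurable)
      have "(\<lambda>p. f (a + snd p)) \<in> borel_measurable (M \<Otimes>\<^sub>M M)" for a
        by measurable
      moreover have "\<tau> n \<in> M \<rightarrow>\<^sub>M count_space (range (\<tau> n))"
        using \<tau>(1)[of n] by (intro measurable_count_space_eq2[THEN iffD2]) (auto simp: simple_function_def)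
      ultimately have "(\<lambda>p. f (\<tau> n (fst p) + snd p)) \<in> borel_measurable (M \<Otimes>\<^sub>M M)"
        using simple_functionD(1)[OF \<tau>(1)[of n]]
        by (intro measurable_compose_countable'[where f="\<lambda>a p. f (a + snd p)" and g="\<lambda>p. \<tau> n (fst p)" and I="range (\<tau> n)"])
          (auto intro: countable_finite measurable_compose[OF measurable_fst])
      then show ?thesis
        by (simp add: case_prod_beta add.commute)
    qed
  qed
qed

lemma Urysohn_real:
  assumes "compact K" "open U" "K \<subseteq> U"
  obtains f :: "'a \<Rightarrow> real" where "continuous_on UNIV f" "\<And>x. 0 \<le> f x" "\<And>x. f x \<le> 1"
    "\<And>x. x \<in> K \<Longrightarrow> f x = 1" "\<And>x. x \<notin> U \<Longrightarrow> f x = 0"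
proof -
  have "Hausdorff_space (euclidean :: 'a topology)"
    unfolding Hausdorff_space_def using hausdorff by (fastforce simp: disjnt_def)
  then have "normal_space (euclidean :: 'a topology)"
    using compact_UNIV by (intro compact_Hausdorff_or_regular_imp_normal_space) (auto simp: compact_space_def)
  moreover have "closed (- U)" "closed K" "disjnt (- U) K"
    using assms by (auto simp: disjnt_def compact_imp_closed closed_Compl)
  ultimately obtain f where f: "continuous_map euclidean (top_of_set {0..1::real}) f" "f ` (- U) \<subseteq> {0}" "f ` K \<subseteq> {1}"
    using Urysohn_lemma[of euclidean "- U" K 0 1] by auto
  then have "f x \<in> {0..1}" for x
    by (auto simp: continuous_map_in_subtopology)
  moreover have "continuous_on UNIV f"
    using f(1) by (auto simp: continuous_map_in_subtopology)
  ultimately show thesis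
    using f(2,3) by (intro that[of f]) auto
qed

end

section \<open>Null sets and sums of independent points\<close>

context compact_haar_group
begin

lemma continuous_translate: "continuous_on UNIV f \<Longrightarrow> continuous_on UNIV (\<lambda>y. f (y + s))" 
  for f :: "'a \<Rightarrow> real"
  by (rule continuous_on_compose2[of UNIV f]) (auto intro!: continuous_intros)

text \<open>Uniform continuity of translations makes the orbit map of \<open>f\<close> into the
  bounded continuous functions with the supremum norm continuous. Its fibres are the cosets of the
  group of periods of \<open>f\<close>, so it gives the quotient by the periods a metric.\<close>

lemma continuous_translation_orbit:
  fixes f :: "'a \<Rightarrow> real"
  assumes f: "continuous_on UNIV f"
  shows "continuous_on UNIV (\<lambda>x. Bcontfun (\<lambda>z. f (z + x)))"
    and "Bcontfun (\<lambda>z. f (z + x)) = Bcontfun (\<lambda>z. f (z + y)) \<longleftrightarrow> (\<forall>z. f (z + x) = f (z + y))"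
proof -
  obtain C where C: "C > 0" "\<And>x. \<bar>f x\<bar> \<le> C"
    using continuous_bounded[OF f] by blast
  have bc: "(\<lambda>z. f (z + x)) \<in> bcontfun" for x
    by (rule bcontfun_normI[of _ C]) (auto simp: C intro: continuous_translate f)
  note ap = Bcontfun_inverse[OF bc]
  show "Bcontfun (\<lambda>z. f (z + x)) = Bcontfun (\<lambda>z. f (z + y)) \<longleftrightarrow> (\<forall>z. f (z + x) = f (z + y))"
    using Bcontfun_inject[OF bc bc] by metis
  have "((\<lambda>x. Bcontfun (\<lambda>z. f (z + x))) \<longlongrightarrow> Bcontfun (\<lambda>z. f (z + t))) (at t)" for t
  proof (rule tendstoI)
    fix e :: real assume "e > 0"
    then obtain U where U: "open U" "t \<in> U" "\<And>s y. s \<in> U \<Longrightarrow> \<bar>f (y + s) - f (y + t)\<bar> < e / 2"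
      using uniform_translate[OF f, of "e / 2"] by (metis half_gt_zero)
    have "dist (Bcontfun (\<lambda>z. f (z + s))) (Bcontfun (\<lambda>z. f (z + t))) \<le> e / 2" if "s \<in> U" for s
      by (rule dist_bound) (use U(3)[OF that] in \<open>auto simp: ap dist_real_def intro: less_imp_le\<close>)
    then have "dist (Bcontfun (\<lambda>z. f (z + s))) (Bcontfun (\<lambda>z. f (z + t))) < e" if "s \<in> U" for s
      using that \<open>e > 0\<close> by fastforce
    then show "\<forall>\<^sub>F s in at t. dist (Bcontfun (\<lambda>z. f (z + s))) (Bcontfun (\<lambda>z. f (z + t))) < e"
      using U(1,2) eventually_at_topological by blast
  qed
  then show "continuous_on UNIV (\<lambda>x. Bcontfun (\<lambda>z. f (z + x)))"
    by (simp add: continuous_on_def)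
qed

text \<open>Inner regularity exhausts \<open>U\<close> up to a null set by compact sets
  \<open>K n\<close>. The Urysohn functions of the pairs \<open>K n\<close>, \<open>U\<close>,
  summed with weights \<open>(1 / 2) ^ n\<close>, give a continuous function positive on every
  \<open>K n\<close> and zero off \<open>U\<close>.\<close>

lemma open_has_conull_cozero:
  assumes "open U"
  obtains f :: "'a \<Rightarrow> real" where "continuous_on UNIV f" "{x. f x \<noteq> 0} \<subseteq> U" "emeasure M (U \<inter> {x. f x = 0}) = 0"
proof -
  have U: "U \<in> sets M"
    using assms by simp
  have "\<exists>K. compact K \<and> K \<subseteq> U \<and> measure M U < measure M K + 1 / Suc n" for n
    using inner_regular[OF U, of "1 / Suc n"] by auto
  then obtain K where "\<forall>n. compact (K n) \<and> K n \<subseteq> U \<and> measure M U < measure M (K n) + 1 / Suc n"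
    using choice[of "\<lambda>n K. compact K \<and> K \<subseteq> U \<and> measure M U < measure M K + 1 / Suc n"] by blast
  then have K: "\<And>n. compact (K n)" "\<And>n. K n \<subseteq> U" "\<And>n. measure M U < measure M (K n) + 1 / Suc n"
    by blast+
  have "\<exists>g::'a \<Rightarrow> real. continuous_on UNIV g \<and> (\<forall>x. 0 \<le> g x \<and> g x \<le> 1) \<and> (\<forall>x\<in>K n. g x = 1) \<and> (\<forall>x. x \<notin> U \<longrightarrow> g x = 0)" for n
    by (rule Urysohn_real[OF K(1)[of n] assms K(2)]) blast
  then obtain g :: "nat \<Rightarrow> 'a \<Rightarrow> real" where "\<forall>n. continuous_on UNIV (g n) \<and> (\<forall>x. 0 \<le> g n x \<and> g n x \<le> 1) \<and>
      (\<forall>x\<in>K n. g n x = 1) \<and> (\<forall>x. x \<notin> U \<longrightarrow> g n x = 0)"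
    using choice[of "\<lambda>n (g::'a \<Rightarrow> real). continuous_on UNIV g \<and> (\<forall>x. 0 \<le> g x \<and> g x \<le> 1) \<and>
      (\<forall>x\<in>K n. g x = 1) \<and> (\<forall>x. x \<notin> U \<longrightarrow> g x = 0)"] by blast
  then have g: "\<And>n. continuous_on UNIV (g n)" "\<And>n x. 0 \<le> g n x" "\<And>n x. g n x \<le> 1"
    "\<And>n x. x \<in> K n \<Longrightarrow> g n x = 1" "\<And>n x. x \<notin> U \<Longrightarrow> g n x = 0"
    by blast+
  define f where "f x = (\<Sum>n. (1 / 2) ^ n * g n x)" for x
  have bd: "norm ((1 / 2) ^ n * g n x) \<le> (1 / 2) ^ n" for n x
    using g(2,3)[of n x] by (simp add: abs_mult mult_left_le)
  have sm: "summable (\<lambda>n. (1 / 2) ^ n * g n x)" for x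
    by (rule summable_comparison_test'[OF _ bd]) (simp add: summable_geometric)
  have "uniform_limit UNIV (\<lambda>n x. \<Sum>i<n. (1 / 2) ^ i * g i x) f sequentially"
    unfolding f_def by (rule Weierstrass_m_test[OF bd]) (simp add: summable_geometric)
  then have cont: "continuous_on UNIV f"
    by (rule uniform_limit_theorem[rotated]) (auto intro!: continuous_intros g(1) always_eventually)
  have pos: "f x \<noteq> 0" if "x \<in> K n" for x n
  proof -
    have "f x > 0"
      unfolding f_def by (rule suminf_pos2[OF sm, of _ n]) (use that g in auto)
    then show ?thesis by simp
  qed
  have fm: "f \<in> borel_measurable M"
    using cont by (rule continuous_measurable)
  then have Z: "{x. f x = 0} \<in> sets M"
    using measurable_sets[OF fm, of "{0}"] by (simp add: vimage_def)
  have "measure M (U \<inter> {x. f x = 0}) \<le> 1 / Suc n" for n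
  proof -
    have "K n \<in> sets M"
      using compact_imp_closed[OF K(1)] borel_closed by auto
    then have "measure M (K n) + measure M (U \<inter> {x. f x = 0}) = measure M (K n \<union> (U \<inter> {x. f x = 0}))"
      using U Z pos by (intro finite_measure_Union[symmetric]) auto
    also have "\<dots> \<le> measure M U"
      using K(2) U by (intro finite_measure_mono) auto
    finally show ?thesis
      using K(3)[of n] by linarith
  qed
  then have "measure M (U \<inter> {x. f x = 0}) \<le> 0"
    by (intro LIMSEQ_le_const[OF LIMSEQ_inverse_real_of_nat]) (auto simp: inverse_eq_divide)
  then have "emeasure M (U \<inter> {x. f x = 0}) = 0"
    by (simp add: emeasure_eq_measure measure_le_0_iff)
  moreover have "{x. f x \<noteq> 0} \<subseteq> U"
  proof
    fix x assume "x \<in> {x. f x \<noteq> 0}"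
    then show "x \<in> U"
      using g(5)[of x] by (cases "x \<in> U") (auto simp: f_def)
  qed
  ultimately show thesis
    using that cont by blast
qed

text \<open>With \<open>f\<close> as in the previous lemma and \<open>Y\<close> the group of periods of \<open>f\<close>, the set \<open>V = U + Y\<close>
  is open and invariant under \<open>Y\<close>, hence a cozero set. A compact subset of \<open>V\<close> on which \<open>f\<close> vanishes
  is covered by finitely many translates of the null set \<open>U \<inter> {f = 0}\<close>.\<close>

lemma open_subset_cozero:
  assumes "open U"
  obtains h :: "'a \<Rightarrow> real" where "continuous_on UNIV h" "U \<subseteq> {x. 0 < h x}"
    "emeasure M {x. 0 < h x} = emeasure M U"
proof -
  obtain f :: "'a \<Rightarrow> real" where f: "continuous_on UNIV f" "{x. f x \<noteq> 0} \<subseteq> U" "emeasure M (U \<inter> {x. f x = 0}) = 0"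
    using open_has_conull_cozero[OF assms] by blast
  have [measurable]: "f \<in> borel_measurable M"
    using f(1) by (rule continuous_measurable)
  have Z: "{x. f x = 0} \<in> sets M"
    using measurable_sets[of f M borel "{0}"] by (simp add: vimage_def)
  define T where "T x = Bcontfun (\<lambda>z. f (z + x))" for x
  have T: "continuous_on UNIV T"
    unfolding T_def by (rule continuous_translation_orbit(1)[OF f(1)])
  have T_eq: "T x = T y \<longleftrightarrow> (\<forall>z. f (z + x) = f (z + y))" for x y
    unfolding T_def by (rule continuous_translation_orbit(2)[OF f(1)])
  define V where "V = {x. \<exists>u\<in>U. T x = T u}"
  have T_shift: "T (a + x) = T (a + y)" if "T x = T y" for x y a
    using that unfolding T_eq by (metis add.assoc)
  \<comment> \<open>If \<open>T x = T u\<close>, then \<open>x - u\<close> is a period of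
    \<open>f\<close>; the translate of \<open>U\<close> by it contains \<open>x\<close> and stays in
    \<open>V\<close>.\<close>
  have open_V: "open V"
  proof (subst open_subopen, safe)
    fix x assume "x \<in> V"
    then obtain u where u: "u \<in> U" "T x = T u"
      by (auto simp: V_def)
    have "open {x'. x' - (x - u) \<in> U}"
      using open_vimage[OF assms, of "\<lambda>x'. x' - (x - u)"] by (simp add: vimage_def continuous_intros)
    moreover have "T x' = T (x' - (x - u))" for x'
      using T_shift[OF u(2), of "x' - x"] by (simp add: algebra_simps)
    ultimately show "\<exists>S. open S \<and> x \<in> S \<and> S \<subseteq> V"
      using u(1) by (intro exI[of _ "{x'. x' - (x - u) \<in> U}"]) (auto simp: V_def)
  qed
  have UV: "U \<subseteq> V"
    by (auto simp: V_def)
  \<comment> \<open>\<open>V\<close> is a union of fibres of \<open>T\<close>, so the distance from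
    \<open>T x\<close> to the compact image of the complement of \<open>V\<close> vanishes exactly
    off \<open>V\<close>. The case \<open>V = UNIV\<close> is separate because
    \<open>infdist\<close> to the empty set is 0.\<close>
  obtain h :: "'a \<Rightarrow> real" where h: "continuous_on UNIV h" "{x. 0 < h x} = V"
  proof (cases "V = UNIV")
    case True
    then show ?thesis
      by (intro that[of "\<lambda>_. 1"]) auto
  next
    case False
    have "compact (T ` (- V))"
      by (intro compact_continuous_image continuous_on_subset[OF T])
        (use closed_Int_compact[OF _ compact_UNIV, of "- V"] open_V in \<open>auto simp: closed_Compl\<close>)
    then have "closed (T ` (- V))"
      by (rule compact_imp_closed)
    then have "infdist (T x) (T ` (- V)) = 0 \<longleftrightarrow> T x \<in> T ` (- V)" for x
      using False in_closed_iff_infdist_zero[of "T ` (- V)" "T x"] by auto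
    moreover have "x \<in> V \<longleftrightarrow> c \<in> V" if "T x = T c" for x c
      using that by (simp add: V_def)
    then have "T x \<in> T ` (- V) \<longleftrightarrow> x \<notin> V" for x
      by blast
    ultimately have "0 < infdist (T x) (T ` (- V)) \<longleftrightarrow> x \<in> V" for x
      using infdist_nonneg[of "T x" "T ` (- V)"] by (metis less_le)
    then show ?thesis
      by (intro that[of "\<lambda>x. infdist (T x) (T ` (- V))"] continuous_on_infdist T) auto
  qed
  have "emeasure M K = 0" if K: "compact K" "K \<subseteq> V \<inter> {x. f x = 0}" for K
  proof -
    have "\<forall>x\<in>K. \<exists>u\<in>U. T x = T u"
      using K by (auto simp: V_def)
    then obtain u where u: "\<And>x. x \<in> K \<Longrightarrow> u x \<in> U \<and> T x = T (u x)"
      by metis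
    have op: "open {x'. (u x - x) + x' \<in> U}" for x
      using open_vimage[OF assms, of "\<lambda>x'. (u x - x) + x'"] by (simp add: vimage_def continuous_intros)
    have "K \<subseteq> (\<Union>x\<in>K. {x'. (u x - x) + x' \<in> U})"
      using u by fastforce
    then obtain D where D: "D \<subseteq> K" "finite D" "K \<subseteq> (\<Union>x\<in>D. {x'. (u x - x) + x' \<in> U})"
      using compactE_image[OF K(1), of K "\<lambda>x. {x'. (u x - x) + x' \<in> U}"] op by blast
    have f_shift: "f x' = f ((u x - x) + x')" if "x \<in> D" for x x'
    proof -
      have "f ((x' - x) + x) = f ((x' - x) + u x)"
        using u[of x] D(1) that T_eq by blast
      then show ?thesis
        by (simp add: algebra_simps)
    qed
    then have "K \<subseteq> (\<Union>x\<in>D. {x'. (u x - x) + x' \<in> U \<inter> {x. f x = 0}})"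
    proof (intro subsetI)
      fix y assume y: "y \<in> K"
      then obtain x where x: "x \<in> D" "(u x - x) + y \<in> U"
        using D(3) by blast
      moreover have "f ((u x - x) + y) = 0"
        using f_shift[OF x(1), of y] K(2) y by auto
      ultimately show "y \<in> (\<Union>x\<in>D. {x'. (u x - x) + x' \<in> U \<inter> {x. f x = 0}})"
        by blast
    qed
    moreover have "(\<Union>x\<in>D. {x'. (u x - x) + x' \<in> U \<inter> {x. f x = 0}}) \<in> null_sets M"
    proof (rule null_sets.finite_UN[OF D(2)])
      fix x assume "x \<in> D"
      have UZ: "U \<inter> {x. f x = 0} \<in> sets M"
        using assms Z by auto
      then have "{x'. (u x - x) + x' \<in> U \<inter> {x. f x = 0}} \<in> sets M"
        using measurable_sets[OF translate_measurable UZ] by (simp add: vimage_def)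
      then show "{x'. (u x - x) + x' \<in> U \<inter> {x. f x = 0}} \<in> null_sets M"
        using emeasure_translate[OF UZ, of "u x - x"] f(3) by (auto simp: null_sets_def)
    qed
    ultimately show ?thesis
      using emeasure_eq_0[OF null_setsD2 null_setsD1] by blast
  qed
  then have null: "measure M K = 0" if "compact K" "K \<subseteq> V \<inter> {x. f x = 0}" for K
    using that by (simp add: measure_def)
  have VZ: "V \<inter> {x. f x = 0} \<in> sets M"
    using open_V Z by auto
  have "measure M (V \<inter> {x. f x = 0}) \<le> 0 + e" if e: "e > 0" for e
  proof -
    obtain K where "compact K" "K \<subseteq> V \<inter> {x. f x = 0}" "measure M (V \<inter> {x. f x = 0}) < measure M K + e"
      using inner_regular[OF VZ e] by blast
    then show ?thesis
      using null by simp
  qed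
  then have "measure M (V \<inter> {x. f x = 0}) \<le> 0"
    by (rule field_le_epsilon)
  then have "emeasure M (V \<inter> {x. f x = 0}) = 0"
    by (simp add: emeasure_eq_measure measure_le_0_iff)
  moreover have "V \<subseteq> U \<union> (V \<inter> {x. f x = 0})"
    using f(2) by auto
  ultimately have "emeasure M V \<le> emeasure M U"
    using VZ assms emeasure_mono[of V "U \<union> (V \<inter> {x. f x = 0})" M] emeasure_Un_null_set[of U M "V \<inter> {x. f x = 0}"]
    by (auto simp: null_sets_def)
  then have "emeasure M {x. 0 < h x} = emeasure M U"
    using emeasure_mono[OF UV, of M] open_V h(2) by simp
  with UV h show thesis
    using that by auto
qed

section \<open>Distribution of a vertex sum under the product measure\<close>

sublocale PS: product_prob_space "\<lambda>_. M" UNIV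
  by unfold_locales

lemma prob_space_PiM: "prob_space (PiM I (\<lambda>_. M))"
  by (intro prob_space_PiM prob_space_axioms)

text \<open>A coordinate \<open>i\<close> with \<open>e i = 1\<close> is integrated innermost: the
  vertex sum is then a translate of a point distributed by the Haar measure. The statement concerns
  cozero sets of continuous functions because their preimages lie in the product
  sigma-algebra.\<close>

lemma emeasure_cube_dot_cozero:
  fixes h :: "'a \<Rightarrow> real"
  assumes e: "e \<in> cube_nz d" and h: "continuous_on UNIV h"
  shows "{t \<in> space (PiM {..<d} (\<lambda>_. M)). 0 < h (x + cube_dot d e t)} \<in> sets (PiM {..<d} (\<lambda>_. M))"
    and "emeasure (PiM {..<d} (\<lambda>_. M)) {t \<in> space (PiM {..<d} (\<lambda>_. M)). 0 < h (x + cube_dot d e t)} = emeasure M {x. 0 < h x}"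
proof -
  let ?P = "PiM {..<d} (\<lambda>_. M)"
  note [measurable] = cube_dot_measurable[OF h]
  show m: "{t \<in> space ?P. 0 < h (x + cube_dot d e t)} \<in> sets ?P"
    by measurable
  obtain i where i: "i < d" "e i = 1"
    using cube_nz_coordinate[OF e] by blast
  let ?I = "{..<d} - {i}"
  have ins: "insert i ?I = {..<d}"
    using i by auto
  interpret I: prob_space "PiM ?I (\<lambda>_. M)"
    by (rule prob_space_PiM)
  have hm: "{x. 0 < h x} \<in> sets M"
    using measurable_sets[OF continuous_measurable[OF h], of "{0<..}"] by (simp add: vimage_def greaterThan_def)
  let ?F = "\<lambda>t. indicator {x. 0 < h x} (x + cube_dot d e t) :: ennreal"
  have "?F \<in> borel_measurable ?P"
    unfolding indicator_def by measurable
  then have "?F \<in> borel_measurable (PiM (insert i ?I) (\<lambda>_. M))"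
    by (simp only: ins)
  then have "integral\<^sup>N (PiM (insert i ?I) (\<lambda>_. M)) ?F = (\<integral>\<^sup>+t. \<integral>\<^sup>+y. ?F (t(i := y)) \<partial>M \<partial>PiM ?I (\<lambda>_. M))"
    by (intro PS.product_nn_integral_insert) auto
  also have "\<dots> = (\<integral>\<^sup>+t. emeasure M {x. 0 < h x} \<partial>PiM ?I (\<lambda>_. M))"
  proof (rule nn_integral_cong)
    fix t assume "t \<in> space (PiM ?I (\<lambda>_. M))"
    define c where "c = x + (\<Sum>j\<in>?I. if e j = 1 then t j else 0)"
    have "(\<integral>\<^sup>+y. ?F (t(i := y)) \<partial>M) = (\<integral>\<^sup>+y. indicator {y. c + y \<in> {x. 0 < h x}} y \<partial>M)"
      by (intro nn_integral_cong) (auto simp: indicator_def cube_dot_update[of i d e, OF i] c_def add.assoc)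
    also have "\<dots> = emeasure M {y. c + y \<in> {x. 0 < h x}}"
      using measurable_sets[OF translate_measurable[of c] hm] by (intro nn_integral_indicator) (auto simp: vimage_def)
    finally show "(\<integral>\<^sup>+y. ?F (t(i := y)) \<partial>M) = emeasure M {x. 0 < h x}"
      using emeasure_translate[OF hm] by simp
  qed
  also have "\<dots> = emeasure M {x. 0 < h x}"
    by (simp add: I.emeasure_space_1)
  finally have "integral\<^sup>N ?P ?F = emeasure M {x. 0 < h x}"
    by (simp only: ins)
  moreover have "integral\<^sup>N ?P ?F = (\<integral>\<^sup>+t. indicator {t \<in> space ?P. 0 < h (x + cube_dot d e t)} t \<partial>?P)"
    by (intro nn_integral_cong) (auto simp: indicator_def)
  ultimately show "emeasure ?P {t \<in> space ?P. 0 < h (x + cube_dot d e t)} = emeasure M {x. 0 < h x}"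
    using m by simp
qed

text \<open>The preimage of \<open>N\<close> itself may be non-measurable. A compact set in the
  complement of \<open>N\<close> of nearly full measure has an open complement containing
  \<open>N\<close>, and this lies in a cozero set of the same small measure. The preimages of such
  cozero sets are measurable and keep their measure, so their intersection is a measurable null
  set.\<close>

lemma AE_cube_dot_not_null:
  assumes N: "N \<in> null_sets M" and e: "e \<in> cube_nz d"
  shows "AE t in PiM {..<d} (\<lambda>_. M). x + cube_dot d e t \<notin> N"
proof -
  let ?P = "PiM {..<d} (\<lambda>_. M)"
  have "\<exists>h::'a \<Rightarrow> real. continuous_on UNIV h \<and> N \<subseteq> {x. 0 < h x} \<and> emeasure M {x. 0 < h x} < 1 / Suc n" for n
  proof -
    have "- N \<in> sets M"
      using null_setsD2[OF N] by auto
    moreover have "measure M (- N) = 1"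
      using prob_compl[OF null_setsD2[OF N]] null_setsD1[OF N] by (simp add: measure_def Compl_eq_Diff_UNIV)
    ultimately obtain K where K: "compact K" "K \<subseteq> - N" "1 < measure M K + 1 / Suc n"
      using inner_regular[of "- N" "1 / Suc n"] by auto
    then have "open (- K)" and Km: "K \<in> sets M"
      using compact_imp_closed[OF K(1)] borel_closed by (auto simp: open_Compl)
    then obtain h :: "'a \<Rightarrow> real" where h: "continuous_on UNIV h" "- K \<subseteq> {x. 0 < h x}" "emeasure M {x. 0 < h x} = emeasure M (- K)"
      using open_subset_cozero by blast
    have "measure M (- K) < 1 / Suc n"
      using K(3) prob_compl[OF Km] by (simp add: Compl_eq_Diff_UNIV)
    then show ?thesis
      using h K(2) by (intro exI[of _ h]) (auto simp: emeasure_eq_measure ennreal_lessI)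
  qed
  then obtain h :: "nat \<Rightarrow> 'a \<Rightarrow> real" where "\<forall>n. continuous_on UNIV (h n) \<and> N \<subseteq> {x. 0 < h n x} \<and>
      emeasure M {x. 0 < h n x} < 1 / Suc n"
    using choice[of "\<lambda>n (h::'a \<Rightarrow> real). continuous_on UNIV h \<and> N \<subseteq> {x. 0 < h x} \<and> emeasure M {x. 0 < h x} < 1 / Suc n"]
    by blast
  then have h: "\<And>n. continuous_on UNIV (h n)" "\<And>n. N \<subseteq> {x. 0 < h n x}"
    "\<And>n. emeasure M {x. 0 < h n x} < 1 / Suc n"
    by blast+
  define A where "A n = {t \<in> space ?P. 0 < h n (x + cube_dot d e t)}" for n
  have A: "A n \<in> sets ?P" "emeasure ?P (A n) \<le> 1 / Suc n" for n
    using emeasure_cube_dot_cozero[OF e h(1), of n x] h(3)[of n] by (auto simp: A_def)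
  have "emeasure ?P (\<Inter>n. A n) \<le> ennreal (1 / Suc n)" for n
    by (rule order_trans[OF emeasure_mono A(2)]) (use A in auto)
  then have "emeasure ?P (\<Inter>n. A n) \<le> 0"
    by (intro LIMSEQ_le_const[OF tendsto_ennrealI[OF LIMSEQ_inverse_real_of_nat, unfolded ennreal_0]])
      (auto simp: inverse_eq_divide)
  moreover have "(\<Inter>n. A n) \<in> sets ?P"
    using A by auto
  ultimately show ?thesis
    using h(2) by (intro AE_I[of _ _ "\<Inter>n. A n"]) (auto simp: A_def)
qed

end

section \<open>Integrals over cubes\<close>

text \<open>The arithmetic-geometric mean inequality for \<open>P\<close> numbers: the powers
  \<open>u i ^ P\<close>, padded with \<open>P - card S\<close> ones. The padding admits fewer than
  \<open>P\<close> factors in Hoelder's inequality, since the ones integrate to one over a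
  probability space.\<close>

lemma prod_le_mean_powers:
  fixes u :: "'i \<Rightarrow> real"
  assumes S: "finite S" "card S \<le> P" "0 < P" and u: "\<And>i. i \<in> S \<Longrightarrow> 0 \<le> u i"
  shows "(\<Prod>i\<in>S. u i) \<le> (\<Sum>i\<in>S. u i ^ P) / P + (P - card S) / P"
proof -
  let ?T = "S <+> {..<P - card S}"
  define x where "x = case_sum (\<lambda>i. u i ^ P) (\<lambda>_::nat. 1)"
  have T: "finite ?T" "card ?T = P"
    using S by (simp_all add: card_Plus)
  then have "?T \<noteq> {}"
    using S(3) by (metis card.empty less_irrefl)
  have "(\<Prod>j\<in>?T. x j) = (\<Prod>i\<in>S. u i) ^ P"
    using S(1) by (simp add: prod.Plus x_def prod_power_distrib)
  moreover have "(\<Sum>j\<in>?T. x j / P) = (\<Sum>i\<in>S. u i ^ P) / P + (P - card S) / P"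
    using S by (simp add: sum.Plus x_def sum_divide_distrib[symmetric] of_nat_diff add_divide_distrib)
  moreover have "(\<Prod>j\<in>?T. x j) powr (1 / card ?T) \<le> (\<Sum>j\<in>?T. x j / card ?T)"
    by (rule arith_geom_mean) (use T \<open>?T \<noteq> {}\<close> u in \<open>auto simp: x_def\<close>)
  moreover have "((\<Prod>i\<in>S. u i) ^ P) powr (1 / P) = (\<Prod>i\<in>S. u i)"
    using prod_nonneg[of S u] u S(3)
    by (simp add: root_powr_inverse[symmetric] real_root_power_cancel)
  ultimately show ?thesis
    by (simp add: T(2))
qed

lemma convex_on_power_nonneg: "convex_on {0::real..} (\<lambda>x. x ^ P)"
  using convex_power_odd[of P] convex_on_subset[OF convex_power_even[of P], of "{0..}"]
  by (cases "even P") (auto simp: convex_real_interval)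

text \<open>Convexity of the power at \<open>s / A\<close> and \<open>t / B\<close>, whose mean with
  the weights \<open>A / (A + B)\<close> and \<open>B / (A + B)\<close> is
  \<open>(s + t) / (A + B)\<close>. For functions of norms at most \<open>A\<close> and
  \<open>B\<close> the integral of the right side is at most \<open>(A + B) ^ P\<close>, which is
  Minkowski's inequality.\<close>

lemma power_add_le_weighted:
  fixes s t A B :: real
  assumes "0 \<le> s" "0 \<le> t" "0 < A" "0 < B"
  shows "(s + t) ^ P \<le> (A + B) ^ P * (A / (A + B) * (s ^ P / A ^ P) + B / (A + B) * (t ^ P / B ^ P))"
proof -
  let ?l = "B / (A + B)"
  have l: "1 - ?l = A / (A + B)"
    using assms by (simp add: field_simps)
  have "((1 - ?l) *\<^sub>R (s / A) + ?l *\<^sub>R (t / B)) ^ P \<le> (1 - ?l) * (s / A) ^ P + ?l * (t / B) ^ P"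
    by (rule convex_onD[OF convex_on_power_nonneg]) (use assms in \<open>auto simp: field_simps\<close>)
  moreover have "(1 - ?l) *\<^sub>R (s / A) + ?l *\<^sub>R (t / B) = (s + t) / (A + B)"
    unfolding l using assms by (simp add: add_divide_distrib)
  ultimately have "((s + t) / (A + B)) ^ P \<le> A / (A + B) * (s ^ P / A ^ P) + ?l * (t ^ P / B ^ P)"
    unfolding l by (simp add: power_divide)
  then have "(A + B) ^ P * ((s + t) / (A + B)) ^ P \<le> (A + B) ^ P * (A / (A + B) * (s ^ P / A ^ P) + ?l * (t ^ P / B ^ P))"
    using assms by (intro mult_left_mono) auto
  moreover have "(A + B) ^ P * ((s + t) / (A + B)) ^ P = (s + t) ^ P"
    using assms by (simp add: power_divide)
  ultimately show ?thesis
    by simp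
qed

lemma powr_two_power: "\<bar>a\<bar> powr (2 ^ k) = \<bar>a\<bar> ^ (2 ^ k)" for a :: real
  using powr_realpow'[of "\<bar>a\<bar>" "2 ^ k"] by simp

section \<open>Norms, Minkowski's and Hoelder's inequalities, and the cube integral bound\<close>

context compact_haar_group
begin

text \<open>A natural exponent permits ordinary powers and \<open>root\<close> in the estimates; at
  \<open>P = 2 ^ k\<close> the value agrees with \<open>Lnorm\<close>.\<close>

definition pnorm :: "nat \<Rightarrow> ('a \<Rightarrow> real) \<Rightarrow> real" where
  "pnorm P f = root P (\<integral>x. \<bar>f x\<bar> ^ P \<partial>M)"

definition Lp :: "nat \<Rightarrow> ('a \<Rightarrow> real) set" where
  "Lp P = {f \<in> borel_measurable M. integrable M (\<lambda>x. \<bar>f x\<bar> ^ P)}"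

lemma prob_UNIV [simp]: "prob UNIV = 1"
  using prob_space by simp

lemma Lspace_eq_Lp: "Lspace (2 ^ k) M = Lp (2 ^ k)"
  by (simp add: Lspace_def Lp_def powr_two_power)

lemma Lnorm_eq_pnorm: "Lnorm (2 ^ k) M f = pnorm (2 ^ k) f"
  by (simp add: Lnorm_def pnorm_def powr_two_power root_powr_inverse)

lemma pnorm_nonneg: "0 < P \<Longrightarrow> 0 \<le> pnorm P f"
  by (simp add: pnorm_def real_root_ge_zero)

lemma pnorm_power: "0 < P \<Longrightarrow> pnorm P f ^ P = (\<integral>x. \<bar>f x\<bar> ^ P \<partial>M)"
  by (simp add: pnorm_def real_root_pow_pos2)

lemma pnorm_le_iff: "0 < P \<Longrightarrow> 0 \<le> C \<Longrightarrow> pnorm P f \<le> C \<longleftrightarrow> (\<integral>x. \<bar>f x\<bar> ^ P \<partial>M) \<le> C ^ P"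
  using pnorm_power[of P f] pnorm_nonneg[of P f] power_mono_iff[of "pnorm P f" C P] by simp

lemma bounded_Lp:
  assumes [measurable]: "f \<in> borel_measurable M" and "\<And>x. \<bar>f x\<bar> \<le> C"
  shows "f \<in> Lp P"
  unfolding Lp_def
proof (safe intro!: assms integrable_const_bound[of _ "C ^ P"] AE_I2)
  show "norm (\<bar>f x\<bar> ^ P) \<le> C ^ P" for x
    using assms(2)[of x] by (auto intro: power_mono)
qed measurable

lemma continuous_Lp: "continuous_on UNIV f \<Longrightarrow> f \<in> Lp P"
  by (metis continuous_bounded continuous_measurable bounded_Lp)

lemma pnorm_bounded:
  assumes "f \<in> borel_measurable M" "\<And>x. \<bar>f x\<bar> \<le> C" "0 < P"
  shows "pnorm P f \<le> C"
proof -
  have C: "0 \<le> C"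
    using assms(2)[of undefined] by linarith
  have "(\<integral>x. \<bar>f x\<bar> ^ P \<partial>M) \<le> (\<integral>x. C ^ P \<partial>M)"
    using bounded_Lp[OF assms(1,2)] assms(2) by (intro integral_mono) (auto simp: Lp_def intro: power_mono)
  then show ?thesis
    using C assms(3) by (simp add: pnorm_le_iff prob_space)
qed

lemma pnorm_cmult: "0 < P \<Longrightarrow> pnorm P (\<lambda>x. c * f x) = \<bar>c\<bar> * pnorm P f"
  by (simp add: pnorm_def abs_mult power_mult_distrib real_root_mult real_root_power_cancel)

lemma pnorm_minus_commute: "pnorm P (\<lambda>x. f x - g x) = pnorm P (\<lambda>x. g x - f x)"
  by (simp add: pnorm_def abs_minus_commute)

lemma pnorm_translate:
  assumes f: "f \<in> borel_measurable M"
  shows "pnorm P (\<lambda>y. f (x + y)) = pnorm P f"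
proof -
  have [measurable]: "f \<in> borel_measurable M" by fact
  have "(\<integral>y. \<bar>f y\<bar> ^ P \<partial>distr M M (\<lambda>y. x + y)) = (\<integral>y. \<bar>f (x + y)\<bar> ^ P \<partial>M)"
    by (rule integral_distr) measurable
  then show ?thesis
    by (simp add: pnorm_def distr_translate)
qed

lemma Lp_translate:
  assumes f: "f \<in> Lp P"
  shows "(\<lambda>y. f (x + y)) \<in> Lp P"
proof -
  have [measurable]: "f \<in> borel_measurable M" and "integrable M (\<lambda>y. \<bar>f y\<bar> ^ P)"
    using f by (auto simp: Lp_def)
  then have "integrable (distr M M (\<lambda>y. x + y)) (\<lambda>y. \<bar>f y\<bar> ^ P)"
    by (simp add: distr_translate)
  then have "integrable M (\<lambda>y. \<bar>f (x + y)\<bar> ^ P)"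
    by (rule integrable_distr[OF translate_measurable])
  then show ?thesis
    by (simp add: Lp_def)
qed

text \<open>The convexity estimate is integrated with \<open>A\<close> and \<open>B\<close> equal to
  the two norms. These are divisors and may vanish, so \<open>e / 2\<close> is added to each. The
  same estimate with \<open>A = B = 1\<close> supplies the dominating function for
  integrability.\<close>

lemma Lp_add_pnorm_add:
  assumes f: "f \<in> Lp P" and g: "g \<in> Lp P" and P: "0 < P"
  shows "(\<lambda>x. f x + g x) \<in> Lp P" and "pnorm P (\<lambda>x. f x + g x) \<le> pnorm P f + pnorm P g"
proof -
  have [measurable]: "f \<in> borel_measurable M" "g \<in> borel_measurable M"
    and int: "integrable M (\<lambda>x. \<bar>f x\<bar> ^ P)" "integrable M (\<lambda>x. \<bar>g x\<bar> ^ P)"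
    using f g by (auto simp: Lp_def)
  let ?R = "\<lambda>A B x. (A + B) ^ P * (A / (A + B) * (\<bar>f x\<bar> ^ P / A ^ P) + B / (A + B) * (\<bar>g x\<bar> ^ P / B ^ P))"
  have le: "\<bar>f x + g x\<bar> ^ P \<le> ?R A B x" if "0 < A" "0 < B" for A B x
    using power_add_le_weighted[OF abs_ge_zero[of "f x"] abs_ge_zero[of "g x"] that, of P]
      power_mono[OF abs_triangle_ineq[of "f x" "g x"], of P] by linarith
  have R: "integrable M (?R A B)" for A B
    using int by (intro integrable_mult_right Bochner_Integration.integrable_add integrable_divide) auto
  have I: "integrable M (\<lambda>x. \<bar>f x + g x\<bar> ^ P)"
    by (rule Bochner_Integration.integrable_bound[OF R[of 1 1]]) (use le[of 1 1] in \<open>auto intro!: AE_I2 order_trans[OF _ abs_ge_self]\<close>)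
  then show "(\<lambda>x. f x + g x) \<in> Lp P"
    by (simp add: Lp_def)
  show "pnorm P (\<lambda>x. f x + g x) \<le> pnorm P f + pnorm P g"
  proof (rule field_le_epsilon)
    fix e :: real assume "0 < e"
    define A where "A = pnorm P f + e / 2"
    define B where "B = pnorm P g + e / 2"
    have pos: "0 < A" "0 < B"
      using \<open>0 < e\<close> pnorm_nonneg[OF P, of f] pnorm_nonneg[OF P, of g] by (auto simp: A_def B_def)
    have "pnorm P f \<le> A" "pnorm P g \<le> B"
      using \<open>0 < e\<close> by (auto simp: A_def B_def)
    then have "(\<integral>x. \<bar>f x\<bar> ^ P \<partial>M) / A ^ P \<le> 1" "(\<integral>x. \<bar>g x\<bar> ^ P \<partial>M) / B ^ P \<le> 1"
      using pos P by (simp_all add: pnorm_le_iff)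
    then have conv: "A / (A + B) * ((\<integral>x. \<bar>f x\<bar> ^ P \<partial>M) / A ^ P) + B / (A + B) * ((\<integral>x. \<bar>g x\<bar> ^ P \<partial>M) / B ^ P)
        \<le> A / (A + B) * 1 + B / (A + B) * 1"
      using pos by (intro add_mono mult_left_mono) auto
    also have "\<dots> = 1"
      using pos by (simp add: add_divide_distrib[symmetric])
    finally have conv: "A / (A + B) * ((\<integral>x. \<bar>f x\<bar> ^ P \<partial>M) / A ^ P) + B / (A + B) * ((\<integral>x. \<bar>g x\<bar> ^ P \<partial>M) / B ^ P) \<le> 1" .
    have "(\<integral>x. \<bar>f x + g x\<bar> ^ P \<partial>M) \<le> (\<integral>x. ?R A B x \<partial>M)"
      by (rule integral_mono[OF I R le]) (use pos in auto)
    also have "\<dots> = (A + B) ^ P * (A / (A + B) * ((\<integral>x. \<bar>f x\<bar> ^ P \<partial>M) / A ^ P) + B / (A + B) * ((\<integral>x. \<bar>g x\<bar> ^ P \<partial>M) / B ^ P))"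
      using int by (simp add: Bochner_Integration.integral_add)
    also have "\<dots> \<le> (A + B) ^ P * 1"
      using conv pos by (intro mult_left_mono) auto
    finally have "pnorm P (\<lambda>x. f x + g x) \<le> A + B"
      using pos P by (simp add: pnorm_le_iff)
    then show "pnorm P (\<lambda>x. f x + g x) \<le> pnorm P f + pnorm P g + e"
      by (simp add: A_def B_def)
  qed
qed

lemma Lp_cmult: "f \<in> Lp P \<Longrightarrow> (\<lambda>x. c * f x) \<in> Lp P"
  by (auto simp: Lp_def abs_mult power_mult_distrib)

lemma Lp_diff:
  assumes "f \<in> Lp P" "g \<in> Lp P" "0 < P"
  shows "(\<lambda>x. f x - g x) \<in> Lp P"
  using Lp_add_pnorm_add(1)[OF assms(1) Lp_cmult[OF assms(2), of "-1"] assms(3)] by simp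

lemma pnorm_le_add_diff:
  assumes "f \<in> Lp P" "g \<in> Lp P" "0 < P"
  shows "pnorm P f \<le> pnorm P g + pnorm P (\<lambda>x. f x - g x)"
  using Lp_add_pnorm_add(2)[OF assms(2) Lp_diff[OF assms] assms(3)] by simp

lemma pnorm_diff_triangle:
  assumes "f \<in> Lp P" "g \<in> Lp P" "h \<in> Lp P" "0 < P"
  shows "pnorm P (\<lambda>x. f x - h x) \<le> pnorm P (\<lambda>x. f x - g x) + pnorm P (\<lambda>x. g x - h x)"
  using Lp_add_pnorm_add(2)[OF Lp_diff[OF assms(1,2)] Lp_diff[OF assms(2,3)]] assms(4) by simp

text \<open>Each factor is divided by its norm and the padded mean inequality is integrated. A
  positive \<open>e\<close> is added to the norms because they may vanish; it tends to zero at the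
  end.\<close>

lemma Holder_prod:
  assumes S: "finite S" "card S \<le> P" "0 < P" and f: "\<And>i. i \<in> S \<Longrightarrow> f i \<in> Lp P"
  shows "integrable M (\<lambda>x. \<Prod>i\<in>S. \<bar>f i x\<bar>)"
    and "(\<integral>x. (\<Prod>i\<in>S. \<bar>f i x\<bar>) \<partial>M) \<le> (\<Prod>i\<in>S. pnorm P (f i))"
proof -
  have fm[measurable]: "\<And>i. i \<in> S \<Longrightarrow> f i \<in> borel_measurable M"
    and int: "\<And>i. i \<in> S \<Longrightarrow> integrable M (\<lambda>x. \<bar>f i x\<bar> ^ P)"
    using f by (auto simp: Lp_def)
  let ?R = "\<lambda>A x. (\<Prod>i\<in>S. A i) * ((\<Sum>i\<in>S. \<bar>f i x\<bar> ^ P / A i ^ P) / P + (P - card S) / P)"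
  have le: "(\<Prod>i\<in>S. \<bar>f i x\<bar>) \<le> ?R A x" if A: "\<And>i. i \<in> S \<Longrightarrow> 0 < A i" for A x
  proof -
    have "(\<Prod>i\<in>S. \<bar>f i x\<bar>) = (\<Prod>i\<in>S. A i) * (\<Prod>i\<in>S. \<bar>f i x\<bar> / A i)"
      unfolding prod.distrib[symmetric] by (rule prod.cong) (use A in \<open>auto simp: less_imp_neq[symmetric]\<close>)
    also have "\<dots> \<le> (\<Prod>i\<in>S. A i) * ((\<Sum>i\<in>S. (\<bar>f i x\<bar> / A i) ^ P) / P + (P - card S) / P)"
      using A by (intro mult_left_mono prod_le_mean_powers[OF S] prod_nonneg) (auto intro: less_imp_le divide_nonneg_pos)
    finally show ?thesis
      by (simp add: power_divide)
  qed
  have R: "integrable M (?R A)" for A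
    using int by (intro integrable_mult_right Bochner_Integration.integrable_add integrable_divide Bochner_Integration.integrable_sum) auto
  show I: "integrable M (\<lambda>x. \<Prod>i\<in>S. \<bar>f i x\<bar>)"
  proof (rule Bochner_Integration.integrable_bound[OF R[of "\<lambda>_. 1"]])
    show "AE x in M. norm (\<Prod>i\<in>S. \<bar>f i x\<bar>) \<le> norm (?R (\<lambda>_. 1) x)"
      using le[of "\<lambda>_. 1"] by (intro AE_I2) (auto simp: prod_nonneg intro!: order_trans[OF _ abs_ge_self])
  qed (intro borel_measurable_prod borel_measurable_abs fm)
  have bound: "(\<integral>x. (\<Prod>i\<in>S. \<bar>f i x\<bar>) \<partial>M) \<le> (\<Prod>i\<in>S. pnorm P (f i) + e)" if e: "0 < e" for e
  proof -
    define A where "A i = pnorm P (f i) + e" for i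
    have pos: "0 < A i" for i
      using e pnorm_nonneg[OF S(3), of "f i"] by (auto simp: A_def)
    have "(\<integral>x. \<bar>f i x\<bar> ^ P \<partial>M) \<le> A i ^ P" for i
      using pnorm_le_iff[OF S(3), of "A i" "f i"] pos[of i] e by (simp add: A_def)
    then have one: "(\<integral>x. \<bar>f i x\<bar> ^ P \<partial>M) / A i ^ P \<le> 1" for i
      using pos[of i] by simp
    have "(\<integral>x. (\<Prod>i\<in>S. \<bar>f i x\<bar>) \<partial>M) \<le> (\<integral>x. ?R A x \<partial>M)"
      by (rule integral_mono[OF I R le]) (use pos in auto)
    also have "\<dots> = (\<Prod>i\<in>S. A i) * ((\<Sum>i\<in>S. (\<integral>x. \<bar>f i x\<bar> ^ P \<partial>M) / A i ^ P) / P + (P - card S) / P)"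
      using int by (simp add: Bochner_Integration.integral_add Bochner_Integration.integral_sum prob_space)
    also have "\<dots> \<le> (\<Prod>i\<in>S. A i) * ((\<Sum>i\<in>S. 1) / P + (P - card S) / P)"
      using one pos by (intro mult_left_mono add_mono divide_right_mono sum_mono prod_nonneg) (auto intro: less_imp_le)
    also have "\<dots> = (\<Prod>i\<in>S. A i)"
      using S by (simp add: add_divide_distrib[symmetric] of_nat_diff)
    finally show ?thesis
      by (simp add: A_def)
  qed
  have "((\<lambda>e. \<Prod>i\<in>S. pnorm P (f i) + e) \<longlongrightarrow> (\<Prod>i\<in>S. pnorm P (f i) + 0)) (at_right 0)"
    by (intro tendsto_intros)
  then show "(\<integral>x. (\<Prod>i\<in>S. \<bar>f i x\<bar>) \<partial>M) \<le> (\<Prod>i\<in>S. pnorm P (f i))"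
    using bound by (intro tendsto_lowerbound[of _ "\<Prod>i\<in>S. pnorm P (f i)" "at_right 0"])
      (auto simp: eventually_at_right_less intro!: eventually_mono[OF eventually_at_right_less])
qed

text \<open>In the integration over coordinate \<open>k\<close> the vertices of
  \<open>subcube d k\<close> are constant and form \<open>?G t\<close>. The remaining factors are
  translates of \<open>h e\<close> by amounts that the earlier coordinates fix, so their norms are
  those of \<open>h e\<close>. Nonnegative integrals are used because integrability of the full
  product is deduced from this very bound.\<close>

lemma nn_integral_subcube_le:
  fixes h :: "(nat \<Rightarrow> nat) \<Rightarrow> 'a \<Rightarrow> real"
  assumes h: "\<And>e. e \<in> cube_nz d \<Longrightarrow> continuous_on UNIV (h e)" and k: "k \<le> d"
  shows "(\<integral>\<^sup>+t. ennreal (\<Prod>e\<in>subcube d k. \<bar>h e (x + cube_dot k e t)\<bar>) \<partial>PiM {..<k} (\<lambda>_. M))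
    \<le> ennreal (\<Prod>e\<in>subcube d k. pnorm (2 ^ (d - 1)) (h e))"
  using k
proof (induction k)
  case 0
  have "subcube d 0 = {}"
    by (auto simp: subcube_def cube_nz_def cube_def PiE_iff extensional_def fun_eq_iff)
  then show ?case
    using prob_space.emeasure_space_1[OF prob_space_PiM[of "{..<0::nat}"]] by simp
next
  case (Suc k)
  let ?P = "2 ^ (d - 1) :: nat"
  let ?T = "{e \<in> subcube d (Suc k). e k = 1}"
  have fin: "finite (subcube d j)" for j
    using finite_cube_nz by (rule finite_subset[rotated]) (auto simp: subcube_def)
  have split: "subcube d (Suc k) = subcube d k \<union> ?T" "subcube d k \<inter> ?T = {}"
  proof -
    have "e k = 0 \<or> e k = 1" if "e \<in> subcube d (Suc k)" for e
      using that Suc.prems PiE_mem[of e "{..<d}" "\<lambda>_. {0, 1}" k] by (auto simp: subcube_def cube_nz_def cube_def)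
    moreover have sub: "e \<in> subcube d k \<longleftrightarrow> e \<in> subcube d (Suc k) \<and> e k = 0" for e
    proof -
      have "k \<le> i \<longleftrightarrow> i = k \<or> Suc k \<le> i" for i
        by linarith
      then show ?thesis
        using Suc.prems unfolding subcube_def by auto
    qed
    ultimately show "subcube d (Suc k) = subcube d k \<union> ?T"
      by (intro set_eqI) (metis (mono_tags, lifting) UnCI UnE mem_Collect_eq)
    show "subcube d k \<inter> ?T = {}"
      using Suc.prems by (auto simp: subcube_def)
  qed
  have h': "continuous_on UNIV (h e)" if "e \<in> subcube d j" for e j
    using that h by (auto simp: subcube_def)
  let ?F = "\<lambda>t. ennreal (\<Prod>e\<in>subcube d (Suc k). \<bar>h e (x + cube_dot (Suc k) e t)\<bar>)"
  let ?G = "\<lambda>t. \<Prod>e\<in>subcube d k. \<bar>h e (x + cube_dot k e t)\<bar>"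
  have "?F \<in> borel_measurable (PiM {..<Suc k} (\<lambda>_. M))"
    by (intro measurable_compose[OF _ measurable_ennreal] borel_measurable_prod borel_measurable_abs cube_dot_measurable h')
  then have "integral\<^sup>N (PiM {..<Suc k} (\<lambda>_. M)) ?F = (\<integral>\<^sup>+t. \<integral>\<^sup>+y. ?F (t(k := y)) \<partial>M \<partial>PiM {..<k} (\<lambda>_. M))"
    unfolding lessThan_Suc by (intro PS.product_nn_integral_insert) auto
  also have "\<dots> \<le> (\<integral>\<^sup>+t. ennreal (?G t) * ennreal (\<Prod>e\<in>?T. pnorm ?P (h e)) \<partial>PiM {..<k} (\<lambda>_. M))"
  proof (rule nn_integral_mono)
    fix t :: "nat \<Rightarrow> 'a"
    have dot: "cube_dot k e (t(k := y)) = cube_dot k e t" for e y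
      by (rule cube_dot_cong) auto
    let ?u = "\<lambda>e y. h e ((x + cube_dot k e t) + y)"
    have u: "?u e \<in> Lp ?P" "pnorm ?P (?u e) = pnorm ?P (h e)" if "e \<in> ?T" for e
      using that Lp_translate[OF continuous_Lp[OF h'[of e "Suc k"]]] pnorm_translate[OF continuous_measurable[OF h'[of e "Suc k"]]]
      by auto
    have "(\<Prod>e\<in>subcube d (Suc k). \<bar>h e (x + cube_dot (Suc k) e (t(k := y)))\<bar>) = ?G t * (\<Prod>e\<in>?T. \<bar>?u e y\<bar>)" for y
    proof -
      have "(\<Prod>e\<in>subcube d (Suc k). \<bar>h e (x + cube_dot (Suc k) e (t(k := y)))\<bar>) =
        (\<Prod>e\<in>subcube d k. \<bar>h e (x + cube_dot (Suc k) e (t(k := y)))\<bar>) * (\<Prod>e\<in>?T. \<bar>h e (x + cube_dot (Suc k) e (t(k := y)))\<bar>)"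
        using split(2) fin by (subst (1) split(1), subst prod.union_disjoint) auto
      also have "(\<Prod>e\<in>subcube d k. \<bar>h e (x + cube_dot (Suc k) e (t(k := y)))\<bar>) = ?G t"
        using Suc.prems by (intro prod.cong) (auto simp: cube_dot_Suc dot subcube_def)
      also have "(\<Prod>e\<in>?T. \<bar>h e (x + cube_dot (Suc k) e (t(k := y)))\<bar>) = (\<Prod>e\<in>?T. \<bar>?u e y\<bar>)"
        by (intro prod.cong) (auto simp: cube_dot_Suc dot add.assoc)
      finally show ?thesis .
    qed
    then have "(\<integral>\<^sup>+y. ?F (t(k := y)) \<partial>M) = (\<integral>\<^sup>+y. ennreal (?G t) * ennreal (\<Prod>e\<in>?T. \<bar>?u e y\<bar>) \<partial>M)"
      by (simp add: ennreal_mult prod_nonneg)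
    also have "\<dots> = ennreal (?G t) * (\<integral>\<^sup>+y. ennreal (\<Prod>e\<in>?T. \<bar>?u e y\<bar>) \<partial>M)"
      using u by (intro nn_integral_cmult measurable_compose[OF _ measurable_ennreal] borel_measurable_prod borel_measurable_abs)
        (auto simp: Lp_def)
    also have "\<dots> \<le> ennreal (?G t) * ennreal (\<Prod>e\<in>?T. pnorm ?P (h e))"
    proof (rule mult_left_mono)
      have "(\<integral>\<^sup>+y. ennreal (\<Prod>e\<in>?T. \<bar>?u e y\<bar>) \<partial>M) = ennreal (\<integral>y. (\<Prod>e\<in>?T. \<bar>?u e y\<bar>) \<partial>M)"
        using Holder_prod(1)[of ?T ?P ?u] fin[of "Suc k"] card_subcube_top[of k d] Suc.prems u
        by (intro nn_integral_eq_integral) (auto simp: prod_nonneg)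
      moreover have "(\<integral>y. (\<Prod>e\<in>?T. \<bar>?u e y\<bar>) \<partial>M) \<le> (\<Prod>e\<in>?T. pnorm ?P (?u e))"
        using fin[of "Suc k"] card_subcube_top[of k d] Suc.prems u by (intro Holder_prod(2)) auto
      moreover have "(\<Prod>e\<in>?T. pnorm ?P (?u e)) = (\<Prod>e\<in>?T. pnorm ?P (h e))"
        by (rule prod.cong[OF refl u(2)])
      ultimately show "(\<integral>\<^sup>+y. ennreal (\<Prod>e\<in>?T. \<bar>?u e y\<bar>) \<partial>M) \<le> ennreal (\<Prod>e\<in>?T. pnorm ?P (h e))"
        by (simp only: ennreal_leI)
    qed simp
    finally show "(\<integral>\<^sup>+y. ?F (t(k := y)) \<partial>M) \<le> ennreal (?G t) * ennreal (\<Prod>e\<in>?T. pnorm ?P (h e))" .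
  qed
  also have "\<dots> = (\<integral>\<^sup>+t. ennreal (?G t) \<partial>PiM {..<k} (\<lambda>_. M)) * ennreal (\<Prod>e\<in>?T. pnorm ?P (h e))"
    by (intro nn_integral_multc measurable_compose[OF _ measurable_ennreal] borel_measurable_prod borel_measurable_abs cube_dot_measurable h')
  also have "\<dots> \<le> ennreal (\<Prod>e\<in>subcube d k. pnorm ?P (h e)) * ennreal (\<Prod>e\<in>?T. pnorm ?P (h e))"
    using Suc.prems by (intro mult_right_mono Suc.IH) auto
  also have "\<dots> = ennreal ((\<Prod>e\<in>subcube d k. pnorm ?P (h e)) * (\<Prod>e\<in>?T. pnorm ?P (h e)))"
    by (intro ennreal_mult[symmetric] prod_nonneg) (auto intro: pnorm_nonneg)
  also have "(\<Prod>e\<in>subcube d k. pnorm ?P (h e)) * (\<Prod>e\<in>?T. pnorm ?P (h e)) = (\<Prod>e\<in>subcube d (Suc k). pnorm ?P (h e))"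
    using split(2) fin by (subst (2) split(1), subst prod.union_disjoint) auto
  finally show ?case .
qed

lemma continuous_cube_integral:
  fixes h :: "(nat \<Rightarrow> nat) \<Rightarrow> 'a \<Rightarrow> real"
  assumes h: "\<And>e. e \<in> cube_nz d \<Longrightarrow> continuous_on UNIV (h e)"
  shows "integrable (PiM {..<d} (\<lambda>_. M)) (\<lambda>t. \<Prod>e\<in>cube_nz d. h e (x + cube_dot d e t))"
    and "(\<integral>t. \<bar>\<Prod>e\<in>cube_nz d. h e (x + cube_dot d e t)\<bar> \<partial>PiM {..<d} (\<lambda>_. M)) \<le> (\<Prod>e\<in>cube_nz d. pnorm (2 ^ (d - 1)) (h e))"
proof -
  let ?P = "PiM {..<d} (\<lambda>_. M)"
  let ?F = "\<lambda>t. \<Prod>e\<in>cube_nz d. h e (x + cube_dot d e t)"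
  have m: "?F \<in> borel_measurable ?P"
    by (intro borel_measurable_prod cube_dot_measurable h)
  have "subcube d d = cube_nz d"
    by (auto simp: subcube_def)
  then have le: "(\<integral>\<^sup>+t. ennreal (norm (?F t)) \<partial>?P) \<le> ennreal (\<Prod>e\<in>cube_nz d. pnorm (2 ^ (d - 1)) (h e))"
    using nn_integral_subcube_le[of d h d x, OF h] by (simp add: abs_prod)
  show I: "integrable ?P ?F"
    by (rule integrableI_bounded[OF m]) (use le in \<open>auto simp: order_le_less_trans\<close>)
  have "ennreal (\<integral>t. norm (?F t) \<partial>?P) = (\<integral>\<^sup>+t. ennreal (norm (?F t)) \<partial>?P)"
    by (intro nn_integral_eq_integral[symmetric] integrable_norm I) auto
  with le have "ennreal (\<integral>t. norm (?F t) \<partial>?P) \<le> ennreal (\<Prod>e\<in>cube_nz d. pnorm (2 ^ (d - 1)) (h e))"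
    by simp
  then show "(\<integral>t. \<bar>?F t\<bar> \<partial>?P) \<le> (\<Prod>e\<in>cube_nz d. pnorm (2 ^ (d - 1)) (h e))"
    by (simp add: ennreal_le_iff prod_nonneg pnorm_nonneg)
qed

end

section \<open>Countable sums of cubic convolution products\<close>

text \<open>Representations are indexed by a single natural number, so double families are
  enumerated by the pairing function. Domination by \<open>a\<close>, whose row sums are summable,
  makes the family absolutely summable, and its sum over the enumeration equals the iterated
  sum.\<close>

lemma sums_prod_decode:
  fixes v a :: "nat \<Rightarrow> nat \<Rightarrow> real"
  assumes a: "\<And>j. a j sums s j" and s: "summable s"
    and v: "\<And>j k. \<bar>v j k\<bar> \<le> a j k" and g: "\<And>j. v j sums g j"
  shows "(\<lambda>n. v (fst (prod_decode n)) (snd (prod_decode n))) sums (\<Sum>j. g j)"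
proof -
  have a0: "0 \<le> a j k" for j k
    using v[of j k] by linarith
  have "s j \<ge> 0" for j
    using a[of j] a0 by (metis sums_unique suminf_nonneg sums_summable)
  then have "s summable_on UNIV"
    by (intro summable_nonneg_imp_summable_on s)
  moreover have "((\<lambda>k. case (j, k) of (j, k) \<Rightarrow> a j k) has_sum s j) UNIV" for j
    using sums_nonneg_imp_has_sum[OF a a0] by simp
  ultimately have "(\<lambda>(j, k). a j k) summable_on UNIV \<times> UNIV"
    by (intro summable_on_SigmaI[where g = s]) (auto simp: a0)
  then have "(\<lambda>p. norm (case p of (j, k) \<Rightarrow> a j k)) summable_on UNIV \<times> UNIV"
    by (simp add: case_prod_unfold abs_of_nonneg[OF a0])
  then have "(\<lambda>p. norm (case p of (j, k) \<Rightarrow> v j k)) summable_on UNIV \<times> UNIV"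
    by (rule Infinite_Sum.abs_summable_on_comparison_test) (auto simp: a0 v)
  then obtain T where T: "((\<lambda>(j, k). v j k) has_sum T) (UNIV \<times> UNIV)"
    using Infinite_Sum.abs_summable_summable unfolding summable_on_def by blast
  have "summable (\<lambda>k. norm (v j k))" for j
    by (rule summable_comparison_test'[OF sums_summable[OF a[of j]], of 0]) (simp add: v)
  then have row: "(v j has_sum g j) UNIV" for j
    by (rule norm_summable_imp_has_sum) (rule g)
  then have "(g has_sum T) UNIV"
    by (intro has_sum_SigmaD[OF T]) simp
  then have "T = (\<Sum>j. g j)"
    by (intro sums_unique has_sum_imp_sums)
  moreover have "((\<lambda>n. (\<lambda>(j, k). v j k) (prod_decode n)) has_sum T) UNIV"
    using T has_sum_reindex_bij_betw[OF bij_prod_decode, of "\<lambda>(j, k). v j k" T] by simp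
  ultimately show ?thesis
    using has_sum_imp_sums by (fastforce simp: case_prod_beta)
qed

text \<open>Since \<sigma> takes finitely many values, the integral is a finite sum over its level
  sets for every function \<open>F\<close> of the value; the values will be points of
  \<open>Q\<close> or pairs of them.\<close>

lemma integral_simple_function_comp:
  fixes F :: "'i \<Rightarrow> real"
  assumes N: "finite_measure N" and \<sigma>: "simple_function N \<sigma>"
  shows "integrable N (\<lambda>\<omega>. F (\<sigma> \<omega>))"
    and "(\<integral>\<omega>. F (\<sigma> \<omega>) \<partial>N) = (\<Sum>i\<in>\<sigma> ` space N. measure N (\<sigma> -` {i} \<inter> space N) * F i)"
proof -
  interpret finite_measure N by fact
  let ?A = "\<lambda>i. \<sigma> -` {i} \<inter> space N"
  have A: "?A i \<in> sets N" for i
    by (rule simple_functionD(2)[OF \<sigma>])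
  have fin: "finite (\<sigma> ` space N)"
    by (rule simple_functionD(1)[OF \<sigma>])
  have eq: "F (\<sigma> \<omega>) = (\<Sum>i\<in>\<sigma> ` space N. indicator (?A i) \<omega> * F i)" if "\<omega> \<in> space N" for \<omega>
  proof -
    have "(\<Sum>i\<in>\<sigma> ` space N. indicator (?A i) \<omega> * F i) = (\<Sum>i\<in>\<sigma> ` space N. if i = \<sigma> \<omega> then F i else 0)"
      using that by (intro sum.cong) (auto simp: indicator_def)
    then show ?thesis
      using fin that by (simp add: sum.delta)
  qed
  have I: "integrable N (\<lambda>\<omega>. indicator (?A i) \<omega> * F i)" for i
    using A by (intro integrable_mult_left integrable_real_indicator) (auto simp: less_top[symmetric])
  have "integrable N (\<lambda>\<omega>. \<Sum>i\<in>\<sigma> ` space N. indicator (?A i) \<omega> * F i)"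
    by (intro Bochner_Integration.integrable_sum I)
  then show "integrable N (\<lambda>\<omega>. F (\<sigma> \<omega>))"
    by (subst Bochner_Integration.integrable_cong[OF refl eq])
  have "(\<integral>\<omega>. F (\<sigma> \<omega>) \<partial>N) = (\<integral>\<omega>. (\<Sum>i\<in>\<sigma> ` space N. indicator (?A i) \<omega> * F i) \<partial>N)"
    by (rule Bochner_Integration.integral_cong[OF refl eq])
  also have "\<dots> = (\<Sum>i\<in>\<sigma> ` space N. (\<integral>\<omega>. indicator (?A i) \<omega> * F i \<partial>N))"
    by (rule Bochner_Integration.integral_sum) (rule I)
  also have "\<dots> = (\<Sum>i\<in>\<sigma> ` space N. measure N (?A i) * F i)"
    using A by simp
  finally show "(\<integral>\<omega>. F (\<sigma> \<omega>) \<partial>N) = (\<Sum>i\<in>\<sigma> ` space N. measure N (?A i) * F i)" .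
qed

lemma sums_half_powers: "(\<lambda>n. \<epsilon> * (1 / 2) ^ Suc n) sums (\<epsilon>::real)"
  using sums_mult[OF power_half_series, of \<epsilon>] by simp

section \<open>Representations by continuous tuples and their closure properties\<close>

locale cubic_algebra = compact_haar_group M
  for M :: "'a::{topological_ab_group_add, t2_space} measure" +
  fixes d :: nat
  assumes d_pos: "1 \<le> d"
begin

abbreviation P :: nat where "P \<equiv> 2 ^ (d - 1)"

abbreviation Q :: "(nat \<Rightarrow> 'a) measure" where "Q \<equiv> PiM {..<d} (\<lambda>_. M)"

sublocale Q: prob_space Q
  by (rule prob_space_PiM)

lemma P_pos: "0 < P"
  by simp

definition continuous_tuple :: "((nat \<Rightarrow> nat) \<Rightarrow> 'a \<Rightarrow> real) \<Rightarrow> bool" where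
  "continuous_tuple f \<longleftrightarrow> (\<forall>e\<in>cube_nz d. continuous_on UNIV (f e))"

lemma A_weight_eq: "A_weight M d f = (\<Prod>e\<in>cube_nz d. pnorm P (f e))"
  by (simp add: A_weight_def Lnorm_eq_pnorm)

lemma A_weight_nonneg: "0 \<le> A_weight M d f"
  by (simp add: A_weight_eq prod_nonneg pnorm_nonneg)

lemma cubic_conv_continuous:
  assumes "continuous_tuple f"
  shows "cubic_conv M d f x = (\<integral>t. (\<Prod>e\<in>cube_nz d. f e (x + cube_dot d e t)) \<partial>Q)"
  unfolding cubic_conv_def using assms
  by (intro integral_completion borel_measurable_prod cube_dot_measurable) (auto simp: continuous_tuple_def)

lemma continuous_tuple_integrable:
  "continuous_tuple f \<Longrightarrow> integrable Q (\<lambda>t. \<Prod>e\<in>cube_nz d. f e (x + cube_dot d e t))"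
  by (intro continuous_cube_integral) (auto simp: continuous_tuple_def)

lemma continuous_tuple_integral_le:
  "continuous_tuple f \<Longrightarrow> (\<integral>t. \<bar>\<Prod>e\<in>cube_nz d. f e (x + cube_dot d e t)\<bar> \<partial>Q) \<le> A_weight M d f"
  unfolding A_weight_eq by (intro continuous_cube_integral) (auto simp: continuous_tuple_def)

lemma abs_cubic_conv_le: "continuous_tuple f \<Longrightarrow> \<bar>cubic_conv M d f x\<bar> \<le> A_weight M d f"
  unfolding cubic_conv_continuous
  by (rule order_trans[OF integral_abs_bound continuous_tuple_integral_le])

text \<open>A consequence of \<open>1 \<le> d\<close> with two uses: the zero tuple has product zero
  and can fill up a series, and a scalar factor finds an entry to be absorbed into.\<close>

lemma cube_nz_nonempty: "cube_nz d \<noteq> {}"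
proof -
  have "(\<lambda>i\<in>{..<d}. 1) \<in> cube_nz d"
    using d_pos by (auto simp: cube_nz_def cube_def fun_eq_iff intro!: exI[of _ 0])
  then show ?thesis
    by blast
qed

text \<open>Restricting the tuples to continuous ones makes every integrand measurable; up to an arbitrarily
  small increase of \<open>r\<close>, this is the condition that the norm of \<open>g\<close> is at most \<open>r\<close>.\<close>

definition A_bound :: "('a \<Rightarrow> real) \<Rightarrow> real \<Rightarrow> bool" where
  "A_bound g r \<longleftrightarrow> (\<exists>c. (\<forall>j. continuous_tuple (c j)) \<and> summable (\<lambda>j. A_weight M d (c j)) \<and>
     (\<Sum>j. A_weight M d (c j)) \<le> r \<and> (\<forall>x. (\<lambda>j. cubic_conv M d (c j) x) sums g x))"

lemma A_bound_mono: "A_bound g r \<Longrightarrow> r \<le> r' \<Longrightarrow> A_bound g r'"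
  unfolding A_bound_def by (meson order_trans)

text \<open>The series of tuples are merged into one by the pairing function. A cubic convolution
  product is bounded by its weight, so the double series of values converges absolutely at each
  point and the merged series has the required sum.\<close>

lemma A_bound_suminf:
  assumes g: "\<And>j. A_bound (g j) (r j)" and r: "summable r"
  shows "A_bound (\<lambda>x. \<Sum>j. g j x) (\<Sum>j. r j)"
proof -
  have "\<exists>c. \<forall>j. (\<forall>k. continuous_tuple (c j k)) \<and> summable (\<lambda>k. A_weight M d (c j k)) \<and>
     (\<Sum>k. A_weight M d (c j k)) \<le> r j \<and> (\<forall>x. (\<lambda>k. cubic_conv M d (c j k) x) sums g j x)"
    using g unfolding A_bound_def by (intro choice) blast
  then obtain c where c: "\<And>j k. continuous_tuple (c j k)" "\<And>j. summable (\<lambda>k. A_weight M d (c j k))"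
     "\<And>j. (\<Sum>k. A_weight M d (c j k)) \<le> r j" "\<And>j x. (\<lambda>k. cubic_conv M d (c j k) x) sums g j x"
    by blast
  define s where "s j = (\<Sum>k. A_weight M d (c j k))" for j
  have w: "(\<lambda>k. A_weight M d (c j k)) sums s j" for j
    using c(2) by (simp add: s_def summable_sums)
  have "norm (s j) \<le> r j" for j
    using c(3) by (simp add: s_def suminf_nonneg c(2) A_weight_nonneg)
  then have s: "summable s"
    by (intro summable_comparison_test'[OF r, of 0])
  let ?c = "\<lambda>n. c (fst (prod_decode n)) (snd (prod_decode n))"
  have 1: "(\<lambda>n. A_weight M d (?c n)) sums (\<Sum>j. s j)"
    by (rule sums_prod_decode[OF w s _ w]) (simp add: A_weight_nonneg)
  have 2: "(\<lambda>n. cubic_conv M d (?c n) x) sums (\<Sum>j. g j x)" for x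
    by (rule sums_prod_decode[OF w s abs_cubic_conv_le[OF c(1)] c(4)])
  have "(\<Sum>j. s j) \<le> (\<Sum>j. r j)"
    by (rule suminf_le[OF _ s r]) (simp add: s_def c(3))
  then show "A_bound (\<lambda>x. \<Sum>j. g j x) (\<Sum>j. r j)"
    unfolding A_bound_def using 1 2 c(1) by (intro exI[of _ ?c]) (auto simp: sums_iff)
qed

lemma continuous_tuple_zero: "continuous_tuple (\<lambda>_ _. 0)"
  by (simp add: continuous_tuple_def)

lemma cubic_conv_zero: "cubic_conv M d (\<lambda>_ _. 0) x = 0"
  using cube_nz_nonempty by (simp add: cubic_conv_def card_gt_0_iff)

lemma A_weight_zero: "A_weight M d (\<lambda>_ _. 0) = 0"
  using cube_nz_nonempty P_pos by (auto simp: A_weight_eq pnorm_def power_0_left)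

lemma A_bound_cubic_conv:
  assumes "continuous_tuple f"
  shows "A_bound (cubic_conv M d f) (A_weight M d f)"
proof -
  let ?c = "\<lambda>j::nat. if j = 0 then f else (\<lambda>_ _. 0)"
  have "(\<lambda>j. A_weight M d (?c j)) = (\<lambda>j. if j = 0 then A_weight M d f else 0)"
    by (auto simp: A_weight_zero)
  then have 1: "(\<lambda>j. A_weight M d (?c j)) sums A_weight M d f"
    using sums_single[of 0 "\<lambda>_. A_weight M d f"] by simp
  have "(\<lambda>j. cubic_conv M d (?c j) x) = (\<lambda>j. if j = 0 then cubic_conv M d f x else 0)" for x
    by (auto simp: cubic_conv_zero)
  then have 2: "(\<lambda>j. cubic_conv M d (?c j) x) sums cubic_conv M d f x" for x
    using sums_single[of 0 "\<lambda>_. cubic_conv M d f x"] by simp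
  show ?thesis
    unfolding A_bound_def using assms 1 2
    by (intro exI[of _ ?c]) (auto simp: sums_iff continuous_tuple_zero)
qed

lemma A_bound_zero: "A_bound (\<lambda>_. 0) 0"
  using A_bound_cubic_conv[OF continuous_tuple_zero]
  by (simp add: A_weight_zero cubic_conv_zero[abs_def])

lemma A_bound_add:
  assumes "A_bound g r" "A_bound h s"
  shows "A_bound (\<lambda>x. g x + h x) (r + s)"
proof -
  let ?G = "\<lambda>j::nat. if j = 0 then g else if j = 1 then h else (\<lambda>_. 0)"
  let ?R = "\<lambda>j::nat. if j = 0 then r else if j = 1 then s else 0"
  have R: "?R sums (\<Sum>j\<in>{0, 1}. ?R j)"
    by (rule sums_finite) auto
  have G: "(\<lambda>j. ?G j x) sums (\<Sum>j\<in>{0, 1}. ?G j x)" for x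
    by (rule sums_finite) auto
  have "A_bound (\<lambda>x. \<Sum>j. ?G j x) (\<Sum>j. ?R j)"
    by (rule A_bound_suminf) (use assms A_bound_zero R in \<open>auto simp: sums_iff\<close>)
  moreover have "(\<Sum>j. ?R j) = r + s"
    using sums_unique[OF R] by simp
  moreover have "(\<Sum>j. ?G j x) = g x + h x" for x
    using sums_unique[OF G[of x]] by simp
  ultimately show ?thesis
    by simp
qed

lemma A_bound_sum:
  assumes "finite S" "\<And>i. i \<in> S \<Longrightarrow> A_bound (g i) (r i)"
  shows "A_bound (\<lambda>x. \<Sum>i\<in>S. g i x) (\<Sum>i\<in>S. r i)"
  using assms by (induction S) (auto intro: A_bound_zero A_bound_add)

lemma cubic_conv_scale:
  assumes e: "e \<in> cube_nz d"
  shows "cubic_conv M d (f(e := (\<lambda>y. a * f e y))) x = a * cubic_conv M d f x"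
    and "A_weight M d (f(e := (\<lambda>y. a * f e y))) = \<bar>a\<bar> * A_weight M d f"
proof -
  have "(\<Prod>e'\<in>cube_nz d. (f(e := (\<lambda>y. a * f e y))) e' (x + cube_dot d e' t)) =
    a * (\<Prod>e'\<in>cube_nz d. f e' (x + cube_dot d e' t))" for t
    using e by (simp add: prod.remove[OF finite_cube_nz e])
  then show "cubic_conv M d (f(e := (\<lambda>y. a * f e y))) x = a * cubic_conv M d f x"
    by (simp add: cubic_conv_def)
  show "A_weight M d (f(e := (\<lambda>y. a * f e y))) = \<bar>a\<bar> * A_weight M d f"
    using e by (simp add: A_weight_eq prod.remove[OF finite_cube_nz e] pnorm_cmult)
qed

lemma A_bound_cmult:
  assumes "A_bound g r"
  shows "A_bound (\<lambda>x. a * g x) (\<bar>a\<bar> * r)"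
proof -
  obtain c where c: "\<And>j. continuous_tuple (c j)" "summable (\<lambda>j. A_weight M d (c j))"
     "(\<Sum>j. A_weight M d (c j)) \<le> r" "\<And>x. (\<lambda>j. cubic_conv M d (c j) x) sums g x"
    using assms unfolding A_bound_def by blast
  obtain e where e: "e \<in> cube_nz d"
    using cube_nz_nonempty by blast
  let ?c = "\<lambda>j. (c j)(e := (\<lambda>y. a * c j e y))"
  have "continuous_tuple (?c j)" for j
    using c(1)[of j] by (auto simp: continuous_tuple_def intro!: continuous_intros)
  moreover have "summable (\<lambda>j. A_weight M d (?c j))"
    unfolding cubic_conv_scale(2)[OF e] by (intro summable_mult c(2))
  moreover have "(\<Sum>j. A_weight M d (?c j)) \<le> \<bar>a\<bar> * r"
    unfolding cubic_conv_scale(2)[OF e] using c(2,3) by (simp add: suminf_mult mult_left_mono)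
  moreover have "(\<lambda>j. cubic_conv M d (?c j) x) sums (a * g x)" for x
    unfolding cubic_conv_scale(1)[OF e] by (intro sums_mult c(4))
  ultimately show ?thesis
    unfolding A_bound_def by (intro exI[of _ ?c]) blast
qed

text \<open>The limit is \<open>g 0\<close> plus the sum of the consecutive differences. Pointwise
  convergence identifies it, and summability of the bounds \<open>s n\<close> yields its
  representation.\<close>

lemma A_bound_LIMSEQ:
  assumes "A_bound (g 0) r" "\<And>n. A_bound (\<lambda>x. g (Suc n) x - g n x) (s n)" "summable s"
    and lim: "\<And>x. (\<lambda>n. g n x) \<longlonglongrightarrow> h x"
  shows "A_bound h (r + (\<Sum>n. s n))"
proof -
  have "A_bound (\<lambda>x. g 0 x + (\<Sum>n. g (Suc n) x - g n x)) (r + (\<Sum>n. s n))"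
    by (intro A_bound_add A_bound_suminf assms)
  moreover have "g 0 x + (\<Sum>n. g (Suc n) x - g n x) = h x" for x
    using sums_unique[OF telescope_sums[OF lim[of x]]] by simp
  ultimately show ?thesis
    by simp
qed

text \<open>The integral is a finite combination of the functions \<open>\<Phi> i\<close>, weighted
  by the measures of the level sets of \<sigma>. The bounds combine with the same weights, so an
  average of functions is bounded by the average of their bounds.\<close>

lemma A_bound_integral_simple:
  assumes N: "finite_measure N" and \<sigma>: "simple_function N \<sigma>"
    and b: "\<And>\<omega>. \<omega> \<in> space N \<Longrightarrow> A_bound (\<Phi> (\<sigma> \<omega>)) (r (\<sigma> \<omega>))"
  shows "A_bound (\<lambda>x. \<integral>\<omega>. \<Phi> (\<sigma> \<omega>) x \<partial>N) (\<integral>\<omega>. r (\<sigma> \<omega>) \<partial>N)"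
proof -
  have eq: "(\<integral>\<omega>. F (\<sigma> \<omega>) \<partial>N) = (\<Sum>i\<in>\<sigma> ` space N. \<bar>measure N (\<sigma> -` {i} \<inter> space N)\<bar> * F i)" for F
    using integral_simple_function_comp(2)[OF N \<sigma>] by simp
  have "A_bound (\<lambda>x. \<Sum>i\<in>\<sigma> ` space N. \<bar>measure N (\<sigma> -` {i} \<inter> space N)\<bar> * \<Phi> i x)
    (\<Sum>i\<in>\<sigma> ` space N. \<bar>measure N (\<sigma> -` {i} \<inter> space N)\<bar> * r i)"
  proof (intro A_bound_sum simple_functionD(1)[OF \<sigma>])
    fix i assume "i \<in> \<sigma> ` space N"
    then have "A_bound (\<Phi> i) (r i)"
      using b by blast
    from A_bound_cmult[OF this, of "\<bar>measure N (\<sigma> -` {i} \<inter> space N)\<bar>"]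
    show "A_bound (\<lambda>x. \<bar>measure N (\<sigma> -` {i} \<inter> space N)\<bar> * \<Phi> i x) (\<bar>measure N (\<sigma> -` {i} \<inter> space N)\<bar> * r i)"
      by simp
  qed
  then show ?thesis
    by (simp add: eq[of "\<lambda>i. \<Phi> i _"] eq[of r])
qed

lemma cubic_conv_diff_one:
  assumes h: "continuous_tuple h" and e: "e \<in> cube_nz d" and a: "continuous_on UNIV a" and b: "continuous_on UNIV b"
  shows "cubic_conv M d (h(e := a)) x - cubic_conv M d (h(e := b)) x = cubic_conv M d (h(e := (\<lambda>y. a y - b y))) x"
proof -
  have c: "continuous_tuple (h(e := a))" "continuous_tuple (h(e := b))" "continuous_tuple (h(e := (\<lambda>y. a y - b y)))"
    using h a b by (auto simp: continuous_tuple_def intro!: continuous_intros)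
  have "(\<Prod>e'\<in>cube_nz d. (h(e := a)) e' (x + cube_dot d e' t)) - (\<Prod>e'\<in>cube_nz d. (h(e := b)) e' (x + cube_dot d e' t))
    = (\<Prod>e'\<in>cube_nz d. (h(e := (\<lambda>y. a y - b y))) e' (x + cube_dot d e' t))" for t
    by (simp add: prod.remove[OF finite_cube_nz e] left_diff_distrib)
  then show ?thesis
    unfolding c[THEN cubic_conv_continuous]
    by (subst Bochner_Integration.integral_diff[OF c(1,2)[THEN continuous_tuple_integrable], symmetric]) simp
qed

lemma A_weight_fun_upd_le:
  assumes e: "e \<in> cube_nz d" and "pnorm P a \<le> \<delta>" "\<And>e'. e' \<in> cube_nz d \<Longrightarrow> pnorm P (h e') \<le> K" and K: "1 \<le> K"
  shows "A_weight M d (h(e := a)) \<le> \<delta> * K ^ card (cube_nz d)"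
proof -
  have "A_weight M d (h(e := a)) = pnorm P a * (\<Prod>e'\<in>cube_nz d - {e}. pnorm P (h e'))"
    by (simp add: A_weight_eq prod.remove[OF finite_cube_nz e])
  also have "\<dots> \<le> \<delta> * (\<Prod>e'\<in>cube_nz d - {e}. K)"
    using assms by (intro mult_mono prod_mono prod_nonneg) (auto simp: pnorm_nonneg order_trans[OF pnorm_nonneg[OF P_pos]])
  also have "\<dots> \<le> \<delta> * K ^ card (cube_nz d)"
    using K order_trans[OF pnorm_nonneg[OF P_pos] assms(2)]
    by (intro mult_left_mono) (auto intro!: power_increasing card_mono)
  finally show ?thesis .
qed

text \<open>The hybrid tuples \<open>?m S\<close> take \<open>f\<close> on \<open>S\<close> and
  \<open>g\<close> elsewhere. Adding a vertex to \<open>S\<close> changes the product by that of a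
  tuple with \<open>f e - g e\<close> at this vertex, whose weight is at most
  \<open>\<delta> * K ^ card (cube_nz d)\<close>; the exponent is rounded up by means of
  \<open>1 \<le> K\<close>. The second conclusion controls the integrands in mean, as the passage to
  non-continuous tuples requires.\<close>

lemma A_bound_cubic_conv_diff:
  fixes \<delta> K :: real
  assumes f: "continuous_tuple f" and g: "continuous_tuple g" and K: "1 \<le> K"
    and fK: "\<And>e. e \<in> cube_nz d \<Longrightarrow> pnorm P (f e) \<le> K"
    and gK: "\<And>e. e \<in> cube_nz d \<Longrightarrow> pnorm P (g e) \<le> K"
    and fg: "\<And>e. e \<in> cube_nz d \<Longrightarrow> pnorm P (\<lambda>y. f e y - g e y) \<le> \<delta>"
  shows "A_bound (\<lambda>x. cubic_conv M d f x - cubic_conv M d g x) (card (cube_nz d) * (\<delta> * K ^ card (cube_nz d)))"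
    and "(\<integral>t. \<bar>(\<Prod>e\<in>cube_nz d. f e (x + cube_dot d e t)) - (\<Prod>e\<in>cube_nz d. g e (x + cube_dot d e t))\<bar> \<partial>Q)
      \<le> card (cube_nz d) * (\<delta> * K ^ card (cube_nz d))"
proof -
  let ?m = "\<lambda>S e. if e \<in> S then f e else g e"
  let ?B = "\<delta> * K ^ card (cube_nz d)"
  let ?p = "\<lambda>f t. \<Prod>e\<in>cube_nz d. f e (x + cube_dot d e t)"
  have m: "continuous_tuple (?m S)" for S
    using f g by (auto simp: continuous_tuple_def)
  have "A_bound (\<lambda>x. cubic_conv M d (?m S) x - cubic_conv M d g x) (card S * ?B) \<and>
      (\<integral>t. \<bar>?p (?m S) t - ?p g t\<bar> \<partial>Q) \<le> card S * ?B"
    if "finite S" "S \<subseteq> cube_nz d" for S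
    using that
  proof (induction S)
    case empty
    then show ?case
      by (simp add: A_bound_zero)
  next
    case (insert e S)
    then have e: "e \<in> cube_nz d"
      by simp
    have upd: "?m (insert e S) = (?m S)(e := f e)" "?m S = (?m S)(e := g e)"
      using insert.hyps by auto
    let ?h = "(?m S)(e := (\<lambda>y. f e y - g e y))"
    have h: "continuous_tuple ?h"
      using m[of S] f g e by (auto simp: continuous_tuple_def intro!: continuous_intros)
    have w: "A_weight M d ?h \<le> ?B"
      by (rule A_weight_fun_upd_le[OF e fg[OF e] _ K]) (use fK gK in auto)
    have "cubic_conv M d (?m (insert e S)) x - cubic_conv M d (?m S) x = cubic_conv M d ?h x" for x
      using cubic_conv_diff_one[OF m[of S] e, of "f e" "g e" x] f g e upd
      by (simp add: continuous_tuple_def)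
    then have "A_bound (\<lambda>x. cubic_conv M d (?m (insert e S)) x - cubic_conv M d (?m S) x) ?B"
      using A_bound_mono[OF A_bound_cubic_conv[OF h] w] by simp
    from A_bound_add[OF this, of "\<lambda>x. cubic_conv M d (?m S) x - cubic_conv M d g x" "card S * ?B"] insert
    have 1: "A_bound (\<lambda>x. cubic_conv M d (?m (insert e S)) x - cubic_conv M d g x) (card (insert e S) * ?B)"
      by (simp add: distrib_right)
    have int: "integrable Q (?p (?m (insert e S)))" "integrable Q (?p (?m S))" "integrable Q (?p g)" "integrable Q (?p ?h)"
      by (intro continuous_tuple_integrable m g h)+
    have step: "?p (?m (insert e S)) t - ?p (?m S) t = ?p ?h t" for t
    proof -
      let ?R = "\<Prod>e'\<in>cube_nz d - {e}. ?m S e' (x + cube_dot d e' t)"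
      have "?p (?m (insert e S)) t = f e (x + cube_dot d e t) * ?R" "?p (?m S) t = g e (x + cube_dot d e t) * ?R"
        "?p ?h t = (f e (x + cube_dot d e t) - g e (x + cube_dot d e t)) * ?R"
        using insert.hyps by (auto simp: prod.remove[OF finite_cube_nz e] intro!: prod.cong)
      then show ?thesis
        by (simp add: left_diff_distrib)
    qed
    then have "\<bar>?p (?m (insert e S)) t - ?p g t\<bar> \<le> \<bar>?p ?h t\<bar> + \<bar>?p (?m S) t - ?p g t\<bar>" for t
      using step[of t] by linarith
    then have "(\<integral>t. \<bar>?p (?m (insert e S)) t - ?p g t\<bar> \<partial>Q) \<le> (\<integral>t. \<bar>?p ?h t\<bar> + \<bar>?p (?m S) t - ?p g t\<bar> \<partial>Q)"
      using int by (intro integral_mono integrable_abs Bochner_Integration.integrable_add Bochner_Integration.integrable_diff)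
    also have "\<dots> = (\<integral>t. \<bar>?p ?h t\<bar> \<partial>Q) + (\<integral>t. \<bar>?p (?m S) t - ?p g t\<bar> \<partial>Q)"
      using int by (intro Bochner_Integration.integral_add integrable_abs Bochner_Integration.integrable_diff)
    also have "\<dots> \<le> ?B + card S * ?B"
      using order_trans[OF continuous_tuple_integral_le[OF h] w] insert by (intro add_mono) auto
    finally have 2: "(\<integral>t. \<bar>?p (?m (insert e S)) t - ?p g t\<bar> \<partial>Q) \<le> card (insert e S) * ?B"
      using insert by (simp add: distrib_right)
    from 1 2 show ?case ..
  qed
  from this[of "cube_nz d"] have *: "A_bound (\<lambda>x. cubic_conv M d (?m (cube_nz d)) x - cubic_conv M d g x) (card (cube_nz d) * ?B)"
    "(\<integral>t. \<bar>?p (?m (cube_nz d)) t - ?p g t\<bar> \<partial>Q) \<le> card (cube_nz d) * ?B"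
    by auto
  have "?p (?m (cube_nz d)) t = ?p f t" for t x
    by (rule prod.cong) auto
  then have "cubic_conv M d (?m (cube_nz d)) x = cubic_conv M d f x" for x
    by (simp add: cubic_conv_continuous m f)
  with *(1) show "A_bound (\<lambda>x. cubic_conv M d f x - cubic_conv M d g x) (card (cube_nz d) * ?B)"
    by simp
  have "?p (?m (cube_nz d)) t = ?p f t" for t
    by (rule prod.cong) auto
  with *(2) show "(\<integral>t. \<bar>?p f t - ?p g t\<bar> \<partial>Q) \<le> card (cube_nz d) * ?B"
    by simp
qed

end

section \<open>Continuous functions are dense\<close>

lemma borel_measurable_completion_AE_eq:
  assumes g: "g \<in> borel_measurable N" and eq: "AE x in N. f x = g x"
  shows "f \<in> borel_measurable (completion N)"
proof (rule measurableI)
  fix A :: "'b set" assume "A \<in> sets borel"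
  then have A: "g -` A \<inter> space (completion N) \<in> sets (completion N)"
    by (rule measurable_sets[OF measurable_completion[OF g]])
  have AE: "AE x in completion N. x \<in> g -` A \<inter> space (completion N) \<longleftrightarrow> x \<in> f -` A \<inter> space (completion N)"
    using AE_completion[OF eq] by eventually_elim auto
  show "f -` A \<inter> space (completion N) \<in> sets (completion N)"
    by (rule completion.in_sets_AE[OF AE A]) simp
qed simp

lemma AE_summable_norm:
  fixes f :: "nat \<Rightarrow> 'a \<Rightarrow> real"
  assumes f: "\<And>i. integrable N (f i)" and s: "summable (\<lambda>i. \<integral>x. \<bar>f i x\<bar> \<partial>N)"
  shows "AE x in N. summable (\<lambda>i. \<bar>f i x\<bar>)"
proof -
  have [measurable]: "f i \<in> borel_measurable N" for i
    using f by (rule borel_measurable_integrable)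
  have "(\<integral>\<^sup>+x. (\<Sum>i. ennreal \<bar>f i x\<bar>) \<partial>N) = (\<Sum>i. \<integral>\<^sup>+x. ennreal \<bar>f i x\<bar> \<partial>N)"
    by (rule nn_integral_suminf) measurable
  also have "\<dots> = (\<Sum>i. ennreal (\<integral>x. \<bar>f i x\<bar> \<partial>N))"
    using f by (intro suminf_cong nn_integral_eq_integral integrable_abs) auto
  also have "\<dots> \<noteq> \<infinity>"
    unfolding infinity_ennreal_def by (rule ennreal_suminf_neq_top[OF s]) simp
  finally have "AE x in N. (\<Sum>i. ennreal \<bar>f i x\<bar>) \<noteq> \<infinity>"
    by (rule nn_integral_PInf_AE[rotated]) measurable
  then show ?thesis
    by eventually_elim (auto intro: summable_suminf_not_top)
qed

text \<open>The differences are summable in mean, so the telescoping series converges almost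
  everywhere to an integrable \<open>g\<close>. The function \<open>q\<close> agrees with
  \<open>g\<close> almost everywhere only and may be non-measurable for \<open>N\<close>; its
  integral is therefore taken over the completion, as in \<open>cubic_conv\<close>.\<close>

lemma integral_telescope_completion:
  fixes p :: "nat \<Rightarrow> 'a \<Rightarrow> real"
  assumes p: "\<And>n. integrable N (p n)" and s: "summable s"
    and le: "\<And>n. (\<integral>x. \<bar>p (Suc n) x - p n x\<bar> \<partial>N) \<le> s n"
    and lim: "AE x in N. (\<lambda>n. p n x) \<longlonglongrightarrow> q x"
  shows "(\<lambda>n. \<integral>x. p n x \<partial>N) \<longlonglongrightarrow> (\<integral>x. q x \<partial>completion N)"
proof -
  let ?f = "\<lambda>n x. p (Suc n) x - p n x"
  have f: "integrable N (?f n)" for n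
    by (intro Bochner_Integration.integrable_diff p)
  have S: "summable (\<lambda>n. \<integral>x. \<bar>?f n x\<bar> \<partial>N)"
    by (rule summable_comparison_test'[OF s, of 0]) (use le in auto)
  note AE = AE_summable_norm[OF f S]
  have AE': "AE x in N. summable (\<lambda>n. norm (?f n x))"
    using AE by simp
  have S': "summable (\<lambda>n. \<integral>x. norm (?f n x) \<partial>N)"
    using S by simp
  define g where "g x = p 0 x + (\<Sum>n. ?f n x)" for x
  have gI: "integrable N g"
    unfolding g_def by (intro Bochner_Integration.integrable_add p integrable_suminf f AE' S')
  have eq: "AE x in N. q x = g x"
    using lim
  proof eventually_elim
    case (elim x)
    then show ?case
      using sums_unique[OF telescope_sums[OF elim]] by (simp add: g_def)
  qed
  have "(\<lambda>n. \<integral>x. ?f n x \<partial>N) sums (\<integral>x. (\<Sum>n. ?f n x) \<partial>N)"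
    by (intro sums_integral f AE' S')
  moreover have "(\<integral>x. ?f n x \<partial>N) = (\<integral>x. p (Suc n) x \<partial>N) - (\<integral>x. p n x \<partial>N)" for n
    by (intro Bochner_Integration.integral_diff p)
  ultimately have "(\<lambda>n. (\<integral>x. p (Suc n) x \<partial>N) - (\<integral>x. p n x \<partial>N)) sums (\<integral>x. (\<Sum>n. ?f n x) \<partial>N)"
    by simp
  then have "(\<lambda>n. (\<integral>x. p n x \<partial>N) - (\<integral>x. p 0 x \<partial>N)) \<longlonglongrightarrow> (\<integral>x. (\<Sum>n. ?f n x) \<partial>N)"
    unfolding sums_def by (simp add: sum_lessThan_telescope[of "\<lambda>n. \<integral>x. p n x \<partial>N"])
  then have "(\<lambda>n. ((\<integral>x. p n x \<partial>N) - (\<integral>x. p 0 x \<partial>N)) + (\<integral>x. p 0 x \<partial>N)) \<longlonglongrightarrow>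
      (\<integral>x. (\<Sum>n. ?f n x) \<partial>N) + (\<integral>x. p 0 x \<partial>N)"
    by (intro tendsto_add tendsto_const)
  moreover have "(\<integral>x. (\<Sum>n. ?f n x) \<partial>N) + (\<integral>x. p 0 x \<partial>N) = (\<integral>x. g x \<partial>N)"
    unfolding g_def using p by (subst Bochner_Integration.integral_add) (auto intro!: integrable_suminf f AE' S')
  moreover have "(\<integral>x. q x \<partial>completion N) = (\<integral>x. g x \<partial>completion N)"
    using borel_measurable_completion_AE_eq[OF borel_measurable_integrable[OF gI] eq]
      measurable_completion[OF borel_measurable_integrable[OF gI]] AE_completion[OF eq]
    by (intro integral_cong_AE)
  moreover have "(\<integral>x. g x \<partial>completion N) = (\<integral>x. g x \<partial>N)"
    using gI by (intro integral_completion) auto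
  ultimately show ?thesis
    by simp
qed

context compact_haar_group
begin

definition Lp_approximable :: "nat \<Rightarrow> ('a \<Rightarrow> real) \<Rightarrow> bool" where
  "Lp_approximable P f \<longleftrightarrow> f \<in> Lp P \<and> (\<forall>e>0. \<exists>c. continuous_on UNIV c \<and> pnorm P (\<lambda>x. f x - c x) < e)"

text \<open>Regularity of \<open>B\<close> and of its complement gives compact \<open>K\<close> and
  \<open>L\<close> with \<open>K \<subseteq> B \<subseteq> - L\<close> and a gap of measure below
  \<open>e ^ P\<close>. A Urysohn function between them equals the indicator off the gap and differs
  from it by at most 1 inside.\<close>

lemma Lp_approximable_indicator:
  assumes B: "B \<in> sets M" and P: "0 < P"
  shows "Lp_approximable P (indicator B)"
  unfolding Lp_approximable_def
proof (intro conjI allI impI)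
  have Bm: "(indicator B :: 'a \<Rightarrow> real) \<in> borel_measurable M"
    using B by (intro borel_measurable_indicator)
  then show BL: "indicator B \<in> Lp P"
    by (rule bounded_Lp[of _ 1]) (auto simp: indicator_def)
  fix e :: real assume e: "0 < e"
  have "0 < e ^ P / 2"
    using e by simp
  then obtain K where K: "compact K" "K \<subseteq> B" "measure M B < measure M K + e ^ P / 2"
    using inner_regular[OF B] by blast
  have B': "- B \<in> sets M"
    using B by auto
  obtain L where L: "compact L" "L \<subseteq> - B" "measure M (- B) < measure M L + e ^ P / 2"
    using inner_regular[OF B' \<open>0 < e ^ P / 2\<close>] by blast
  have cl: "K \<in> sets M" "L \<in> sets M" "open (- L)"
    using compact_imp_closed[OF K(1)] compact_imp_closed[OF L(1)] borel_closed by (auto simp: open_Compl)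
  obtain c :: "'a \<Rightarrow> real" where c: "continuous_on UNIV c" "\<And>x. 0 \<le> c x" "\<And>x. c x \<le> 1"
    "\<And>x. x \<in> K \<Longrightarrow> c x = 1" "\<And>x. x \<notin> - L \<Longrightarrow> c x = 0"
    using Urysohn_real[OF K(1) cl(3)] K(2) L(2) by blast
  let ?D = "- L - K"
  have D: "?D \<in> sets M"
    using cl by auto
  have "measure M ?D = measure M (- L) - measure M K"
    using cl K(2) L(2) by (intro finite_measure_Diff) auto
  also have "measure M (- L) = 1 - measure M L"
    using prob_compl[OF cl(2)] by (simp add: Compl_eq_Diff_UNIV)
  also have "1 - measure M L - measure M K < e ^ P"
    using K(3) L(3) prob_compl[OF B] by (simp add: Compl_eq_Diff_UNIV)
  finally have small: "measure M ?D < e ^ P" .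
  have "(\<integral>x. \<bar>indicator B x - c x\<bar> ^ P \<partial>M) \<le> (\<integral>x. indicator ?D x \<partial>M)"
  proof (rule integral_mono)
    show "integrable M (\<lambda>x. \<bar>indicator B x - c x\<bar> ^ P)"
      using Lp_diff[OF BL continuous_Lp[OF c(1)] P] by (simp add: Lp_def)
    show "integrable M (indicator ?D :: 'a \<Rightarrow> real)"
      using D by (intro integrable_real_indicator) (auto simp: less_top[symmetric])
    show "\<bar>indicator B x - c x\<bar> ^ P \<le> indicator ?D x" for x
    proof (cases "x \<in> ?D")
      case True
      have "\<bar>indicator B x - c x\<bar> \<le> 1"
        using c(2,3)[of x] by (auto simp: indicator_def)
      then show ?thesis
        using True by (simp add: power_le_one)
    next
      case False
      then have "indicator B x - c x = 0"
        using c(4,5)[of x] K(2) L(2) by (cases "x \<in> K") (auto simp: indicator_def)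
      then show ?thesis
        using P by (simp add: power_0_left)
    qed
  qed
  also have "\<dots> = measure M ?D"
    using D by simp
  finally have "pnorm P (\<lambda>x. indicator B x - c x) ^ P < e ^ P"
    using small by (simp add: pnorm_power[OF P])
  then have "pnorm P (\<lambda>x. indicator B x - c x) < e"
    by (rule power_less_imp_less_base) (use e in simp)
  with c(1) show "\<exists>c. continuous_on UNIV c \<and> pnorm P (\<lambda>x. indicator B x - c x) < e"
    by blast
qed

lemma Lp_approximable_add:
  assumes f: "Lp_approximable P f" and g: "Lp_approximable P g" and P: "0 < P"
  shows "Lp_approximable P (\<lambda>x. f x + g x)"
  unfolding Lp_approximable_def
proof (intro conjI allI impI)
  have L: "f \<in> Lp P" "g \<in> Lp P"
    using f g by (auto simp: Lp_approximable_def)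
  then show "(\<lambda>x. f x + g x) \<in> Lp P"
    using P by (rule Lp_add_pnorm_add)
  fix e :: real assume "0 < e"
  then have "0 < e / 2" by simp
  then obtain a b where a: "continuous_on UNIV a" "pnorm P (\<lambda>x. f x - a x) < e / 2"
    and b: "continuous_on UNIV b" "pnorm P (\<lambda>x. g x - b x) < e / 2"
    using f g unfolding Lp_approximable_def by blast
  have "pnorm P (\<lambda>x. (f x - a x) + (g x - b x)) \<le> pnorm P (\<lambda>x. f x - a x) + pnorm P (\<lambda>x. g x - b x)"
    using Lp_diff L continuous_Lp a(1) b(1) P by (intro Lp_add_pnorm_add) auto
  also have "\<dots> < e"
    using a b by linarith
  finally have "pnorm P (\<lambda>x. (f x + g x) - (a x + b x)) < e"
    by (simp add: algebra_simps)
  then show "\<exists>c. continuous_on UNIV c \<and> pnorm P (\<lambda>x. (f x + g x) - c x) < e"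
    using a(1) b(1) by (intro exI[of _ "\<lambda>x. a x + b x"]) (auto intro: continuous_on_add)
qed

lemma Lp_approximable_cmult:
  assumes f: "Lp_approximable P f" and P: "0 < P"
  shows "Lp_approximable P (\<lambda>x. a * f x)"
  unfolding Lp_approximable_def
proof (intro conjI allI impI)
  show "(\<lambda>x. a * f x) \<in> Lp P"
    using f by (intro Lp_cmult) (auto simp: Lp_approximable_def)
  fix e :: real assume "0 < e"
  then have "0 < e / (\<bar>a\<bar> + 1)" by simp
  then obtain c where c: "continuous_on UNIV c" "pnorm P (\<lambda>x. f x - c x) < e / (\<bar>a\<bar> + 1)"
    using f unfolding Lp_approximable_def by blast
  have "pnorm P (\<lambda>x. a * f x - a * c x) = \<bar>a\<bar> * pnorm P (\<lambda>x. f x - c x)"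
    using pnorm_cmult[OF P, of a "\<lambda>x. f x - c x"] by (simp add: right_diff_distrib)
  also have "\<dots> \<le> (\<bar>a\<bar> + 1) * pnorm P (\<lambda>x. f x - c x)"
    using pnorm_nonneg[OF P] by (intro mult_right_mono) auto
  also have "\<dots> < e"
    using c(2) by (simp add: pos_less_divide_eq mult.commute)
  finally show "\<exists>c. continuous_on UNIV c \<and> pnorm P (\<lambda>x. a * f x - c x) < e"
    using c(1) by (intro exI[of _ "\<lambda>x. a * c x"]) (auto intro: continuous_on_mult_left)
qed

lemma Lp_approximable_simple:
  assumes s: "simple_function M s" and P: "0 < P"
  shows "Lp_approximable P s"
proof -
  have "Lp_approximable P (\<lambda>x. \<Sum>y\<in>S. y * indicator (s -` {y}) x)" if "finite S" for S
    using that
  proof (induction S)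
    case empty
    have "(indicator {} :: 'a \<Rightarrow> real) = (\<lambda>_. 0)"
      by (simp add: fun_eq_iff)
    then show ?case
      using Lp_approximable_indicator[of "{}", OF _ P] by (simp only: sum.empty sets.empty_sets)
  next
    case (insert y S)
    have "s -` {y} \<in> sets M"
      using simple_functionD(2)[OF s, of "{y}"] by simp
    then have "Lp_approximable P (\<lambda>x. y * indicator (s -` {y}) x + (\<Sum>y\<in>S. y * indicator (s -` {y}) x))"
      using insert by (intro Lp_approximable_add Lp_approximable_cmult Lp_approximable_indicator P)
    then show ?case
      using insert.hyps by (simp only: sum.insert not_False_eq_True)
  qed
  moreover have "s = (\<lambda>x. \<Sum>y\<in>range s. y * indicator (s -` {y}) x)"
  proof
    fix x
    have "finite (range s)"
      using simple_functionD(1)[OF s] by simp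
    then have "(\<Sum>y\<in>range s. if y = s x then y else 0) = s x"
      by (simp add: sum.delta)
    moreover have "(\<Sum>y\<in>range s. y * indicator (s -` {y}) x) = (\<Sum>y\<in>range s. if y = s x then y else 0)"
      by (rule sum.cong) (auto simp: indicator_def)
    ultimately show "s x = (\<Sum>y\<in>range s. y * indicator (s -` {y}) x)"
      by simp
  qed
  ultimately show ?thesis
    using simple_functionD(1)[OF s] by (metis space_M)
qed

lemma continuous_dense_Lp:
  assumes f: "f \<in> Lp P" and P: "0 < P" and e: "0 < e"
  obtains c where "continuous_on UNIV c" "pnorm P (\<lambda>x. f x - c x) < e"
proof -
  have fm[measurable]: "f \<in> borel_measurable M" and fI: "integrable M (\<lambda>x. \<bar>f x\<bar> ^ P)"
    using f by (auto simp: Lp_def)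
  obtain s where s: "\<And>i. simple_function M (s i)" "\<And>x. (\<lambda>i. s i x) \<longlonglongrightarrow> f x" "\<And>i x. \<bar>s i x\<bar> \<le> 2 * \<bar>f x\<bar>"
    using borel_measurable_implies_sequence_metric[OF fm, of 0] by auto
  have [measurable]: "s i \<in> borel_measurable M" for i
    using s(1) by (rule borel_measurable_simple_function)
  have "(\<lambda>i. \<integral>x. \<bar>f x - s i x\<bar> ^ P \<partial>M) \<longlonglongrightarrow> (\<integral>x. 0 \<partial>M)"
  proof (rule integral_dominated_convergence)
    \<comment> \<open>The simple functions satisfy
      \<open>\<bar>s i x\<bar> \<le> 2 * \<bar>f x\<bar>\<close>, so their distance to
      \<open>f\<close> is at most three times \<open>\<bar>f x\<bar>\<close>.\<close>
    show "integrable M (\<lambda>x. 3 ^ P * \<bar>f x\<bar> ^ P)"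
      using fI by simp
    show "AE x in M. (\<lambda>i. \<bar>f x - s i x\<bar> ^ P) \<longlonglongrightarrow> 0"
    proof (rule AE_I2)
      fix x
      have "(\<lambda>i. \<bar>f x - s i x\<bar> ^ P) \<longlonglongrightarrow> \<bar>f x - f x\<bar> ^ P"
        by (intro tendsto_intros s(2))
      moreover have "\<bar>f x - f x\<bar> ^ P = 0"
        using P by simp
      ultimately show "(\<lambda>i. \<bar>f x - s i x\<bar> ^ P) \<longlonglongrightarrow> 0"
        by (simp only:)
    qed
    show "AE x in M. norm (\<bar>f x - s i x\<bar> ^ P) \<le> 3 ^ P * \<bar>f x\<bar> ^ P" for i
    proof (rule AE_I2)
      fix x
      have "\<bar>f x - s i x\<bar> \<le> 3 * \<bar>f x\<bar>"
        using s(3)[of i x] by linarith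
      then have "\<bar>f x - s i x\<bar> ^ P \<le> (3 * \<bar>f x\<bar>) ^ P"
        by (intro power_mono) auto
      then show "norm (\<bar>f x - s i x\<bar> ^ P) \<le> 3 ^ P * \<bar>f x\<bar> ^ P"
        by (simp add: power_mult_distrib)
    qed
  qed measurable
  then have "\<forall>\<^sub>F i in sequentially. (\<integral>x. \<bar>f x - s i x\<bar> ^ P \<partial>M) < (e / 2) ^ P"
    using e by (intro order_tendstoD(2)) auto
  then obtain i where "(\<integral>x. \<bar>f x - s i x\<bar> ^ P \<partial>M) < (e / 2) ^ P"
    by (auto simp: eventually_sequentially)
  then have "pnorm P (\<lambda>x. f x - s i x) ^ P < (e / 2) ^ P"
    by (simp add: pnorm_power[OF P])
  then have i: "pnorm P (\<lambda>x. f x - s i x) < e / 2"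
    by (rule power_less_imp_less_base) (use e in simp)
  have appr: "Lp_approximable P (s i)"
    by (rule Lp_approximable_simple[OF s(1) P])
  then obtain c where c: "continuous_on UNIV c" "pnorm P (\<lambda>x. s i x - c x) < e / 2"
    using e unfolding Lp_approximable_def by (meson half_gt_zero)
  have "pnorm P (\<lambda>x. f x - c x) \<le> pnorm P (\<lambda>x. f x - s i x) + pnorm P (\<lambda>x. s i x - c x)"
    using appr by (intro pnorm_diff_triangle f continuous_Lp[OF c(1)] P) (simp add: Lp_approximable_def)
  then show thesis
    using that[OF c(1)] i c(2) by linarith
qed

text \<open>At a geometric rate the integrals of the powers of the differences are summable; hence
  almost everywhere these powers have a finite sum and tend to zero.\<close>

lemma AE_LIMSEQ_of_pnorm:
  assumes f: "f \<in> Lp P" and F: "\<And>n. F n \<in> Lp P" and P: "0 < P"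
    and le: "\<And>n. pnorm P (\<lambda>x. f x - F n x) \<le> (1 / 2) ^ n"
  shows "AE x in M. (\<lambda>n. F n x) \<longlonglongrightarrow> f x"
proof -
  have I: "integrable M (\<lambda>x. \<bar>f x - F n x\<bar> ^ P)" for n
    using Lp_diff[OF f F P] by (simp add: Lp_def)
  have "(\<integral>x. \<bar>f x - F n x\<bar> ^ P \<partial>M) \<le> (1 / 2) ^ n" for n
  proof -
    have "(\<integral>x. \<bar>f x - F n x\<bar> ^ P \<partial>M) \<le> ((1 / 2) ^ n) ^ P"
      using le[of n] pnorm_le_iff[OF P] by simp
    also have "\<dots> \<le> ((1 / 2) ^ n) ^ 1"
      using P by (intro power_decreasing) (auto simp: power_le_one)
    finally show ?thesis by simp
  qed
  then have "summable (\<lambda>n. \<integral>x. \<bar>\<bar>f x - F n x\<bar> ^ P\<bar> \<partial>M)"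
    by (intro summable_comparison_test'[OF summable_geometric[of "1 / 2 :: real"], of 0]) simp_all
  from AE_summable_norm[OF I this] show ?thesis
  proof eventually_elim
    case (elim x)
    then have "(\<lambda>n. \<bar>f x - F n x\<bar> ^ P) \<longlonglongrightarrow> 0"
      using summable_LIMSEQ_zero[OF elim] by simp
    then have "(\<lambda>n. root P (\<bar>f x - F n x\<bar> ^ P)) \<longlonglongrightarrow> root P 0"
      by (rule tendsto_real_root)
    then have "(\<lambda>n. \<bar>f x - F n x\<bar>) \<longlonglongrightarrow> 0"
      using P by (simp add: real_root_power_cancel)
    then have "(\<lambda>n. f x - F n x) \<longlonglongrightarrow> 0"
      by (rule tendsto_rabs_zero_cancel)
    then have "(\<lambda>n. f x - (f x - F n x)) \<longlonglongrightarrow> f x - 0"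
      by (intro tendsto_diff tendsto_const)
    then show ?case
      by simp
  qed
qed

end

section \<open>Approximation by continuous tuples\<close>

lemma abs_prod_diff_le:
  fixes a b :: "'i \<Rightarrow> real" and K \<eta> :: real
  assumes "finite S" and K: "1 \<le> K"
    and ab: "\<And>i. i \<in> S \<Longrightarrow> \<bar>a i\<bar> \<le> K" "\<And>i. i \<in> S \<Longrightarrow> \<bar>b i\<bar> \<le> K" "\<And>i. i \<in> S \<Longrightarrow> \<bar>a i - b i\<bar> \<le> \<eta>"
  shows "\<bar>(\<Prod>i\<in>S. a i) - (\<Prod>i\<in>S. b i)\<bar> \<le> card S * (\<eta> * K ^ card S)"
  using assms(1) ab
proof (induction S)
  case empty
  then show ?case by simp
next
  case (insert i S)
  let ?A = "\<Prod>i\<in>S. a i" and ?B = "\<Prod>i\<in>S. b i" and ?n = "card S"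
  have \<eta>: "0 \<le> \<eta>"
    using insert.prems(3)[of i] by (meson abs_ge_zero insertI1 order_trans)
  have "\<bar>?A\<bar> \<le> (\<Prod>i\<in>S. K)"
    unfolding abs_prod using insert.prems(1) by (intro prod_mono) auto
  then have A: "\<bar>?A\<bar> \<le> K ^ ?n"
    by simp
  have "\<bar>(\<Prod>i\<in>insert i S. a i) - (\<Prod>i\<in>insert i S. b i)\<bar> = \<bar>(a i - b i) * ?A + b i * (?A - ?B)\<bar>"
    using insert.hyps by (simp add: algebra_simps)
  also have "\<dots> \<le> \<bar>a i - b i\<bar> * \<bar>?A\<bar> + \<bar>b i\<bar> * \<bar>?A - ?B\<bar>"
    by (metis abs_mult abs_triangle_ineq)
  also have "\<dots> \<le> \<eta> * K ^ ?n + K * (?n * (\<eta> * K ^ ?n))"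
    using insert A \<eta> K by (intro add_mono mult_mono) auto
  also have "\<dots> \<le> \<eta> * K ^ Suc ?n + K * (?n * (\<eta> * K ^ ?n))"
    using \<eta> K by (intro add_right_mono mult_left_mono power_increasing) auto
  also have "\<dots> = card (insert i S) * (\<eta> * K ^ card (insert i S))"
    using insert.hyps by (simp add: algebra_simps)
  finally show ?case .
qed

text \<open>Replaces Fubini's theorem: the outer variable enters through finitely many values of
  \<sigma>, so the interchange is linearity of the inner integral.\<close>

lemma integral_simple_swap:
  fixes \<Psi> :: "'i \<Rightarrow> 'b \<Rightarrow> real"
  assumes N: "finite_measure N" and \<sigma>: "simple_function N \<sigma>" and \<Psi>: "\<And>i. integrable L (\<Psi> i)"
  shows "(\<integral>\<omega>. (\<integral>u. \<Psi> (\<sigma> \<omega>) u \<partial>L) \<partial>N) = (\<integral>u. (\<integral>\<omega>. \<Psi> (\<sigma> \<omega>) u \<partial>N) \<partial>L)"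
    and "integrable L (\<lambda>u. \<integral>\<omega>. \<Psi> (\<sigma> \<omega>) u \<partial>N)"
proof -
  let ?m = "\<lambda>i. measure N (\<sigma> -` {i} \<inter> space N)"
  have eq: "(\<integral>\<omega>. \<Psi> (\<sigma> \<omega>) u \<partial>N) = (\<Sum>i\<in>\<sigma> ` space N. ?m i * \<Psi> i u)" for u
    using integral_simple_function_comp(2)[OF N \<sigma>, of "\<lambda>i. \<Psi> i u"] .
  have "(\<integral>\<omega>. (\<integral>u. \<Psi> (\<sigma> \<omega>) u \<partial>L) \<partial>N) = (\<Sum>i\<in>\<sigma> ` space N. ?m i * (\<integral>u. \<Psi> i u \<partial>L))"
    using integral_simple_function_comp(2)[OF N \<sigma>, of "\<lambda>i. \<integral>u. \<Psi> i u \<partial>L"] .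
  also have "\<dots> = (\<integral>u. (\<Sum>i\<in>\<sigma> ` space N. ?m i * \<Psi> i u) \<partial>L)"
    using \<Psi> by (subst Bochner_Integration.integral_sum) auto
  finally show "(\<integral>\<omega>. (\<integral>u. \<Psi> (\<sigma> \<omega>) u \<partial>L) \<partial>N) = (\<integral>u. (\<integral>\<omega>. \<Psi> (\<sigma> \<omega>) u \<partial>N) \<partial>L)"
    by (simp only: eq)
  show "integrable L (\<lambda>u. \<integral>\<omega>. \<Psi> (\<sigma> \<omega>) u \<partial>N)"
    unfolding eq using \<Psi> by (intro Bochner_Integration.integrable_sum integrable_mult_right)
qed

lemma simple_function_restrict:
  assumes "finite I" "\<And>i. i \<in> I \<Longrightarrow> simple_function N (g i)"
  shows "simple_function N (\<lambda>\<omega>. \<lambda>i\<in>I. g i \<omega>)"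
  using assms
proof (induction I)
  case empty
  then show ?case by simp
next
  case (insert i I)
  have "simple_function N (\<lambda>\<omega>. \<lambda>j\<in>I. g j \<omega>)"
    by (rule insert.IH) (rule insert.prems, simp)
  moreover have "simple_function N (g i)"
    by (rule insert.prems) simp
  ultimately have "simple_function N (\<lambda>\<omega>. (\<lambda>j\<in>I. g j \<omega>)(i := g i \<omega>))"
    by (rule simple_function_compose2)
  moreover have "(\<lambda>\<omega>. \<lambda>j\<in>insert i I. g j \<omega>) = (\<lambda>\<omega>. (\<lambda>j\<in>I. g j \<omega>)(i := g i \<omega>))"
    using insert.hyps by (auto simp: fun_eq_iff restrict_def)
  ultimately show ?case
    by (simp only:)
qed

section \<open>Translations of the product measure and norms of shifted products\<close>

context compact_haar_group
begin

text \<open>Boxes determine the product measure, and on a box invariance holds factor by factor. The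
  restriction to \<open>I\<close> keeps the translated point extensional, hence in the product
  space.\<close>

lemma integral_PiM_translate:
  fixes g :: "(nat \<Rightarrow> 'a) \<Rightarrow> real"
  assumes I: "finite I" and g: "g \<in> borel_measurable (PiM I (\<lambda>_. M))"
  shows "(\<integral>t. g (\<lambda>i\<in>I. u i + t i) \<partial>PiM I (\<lambda>_. M)) = (\<integral>t. g t \<partial>PiM I (\<lambda>_. M))"
proof -
  let ?P = "PiM I (\<lambda>_. M)"
  let ?T = "\<lambda>t. \<lambda>i\<in>I. u i + t i"
  have T: "?T \<in> ?P \<rightarrow>\<^sub>M ?P"
  proof (rule measurable_restrict)
    fix i assume "i \<in> I"
    then have "(\<lambda>t. t i) \<in> ?P \<rightarrow>\<^sub>M M"
      by (rule measurable_component_singleton)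
    then show "(\<lambda>t. u i + t i) \<in> ?P \<rightarrow>\<^sub>M M"
      by (rule measurable_compose[OF _ translate_measurable])
  qed
  have "distr ?P ?P ?T = ?P"
  proof (rule PS.PiM_eqI[OF I])
    fix A assume A: "\<And>i. i \<in> I \<Longrightarrow> A i \<in> sets M"
    have "?T -` Pi\<^sub>E I A \<inter> space ?P = (\<Pi>\<^sub>E i\<in>I. {y. u i + y \<in> A i})"
      by (auto simp: space_PiM PiE_iff extensional_def)
    moreover have "emeasure ?P (\<Pi>\<^sub>E i\<in>I. {y. u i + y \<in> A i}) = (\<Prod>i\<in>I. emeasure M {y. u i + y \<in> A i})"
    proof (rule PS.emeasure_PiM[OF I])
      show "{y. u i + y \<in> A i} \<in> sets M" if "i \<in> I" for i
        using measurable_sets[OF translate_measurable A[OF that], of "u i"] by (simp add: vimage_def)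
    qed
    moreover have "Pi\<^sub>E I A \<in> sets ?P"
      using I A by (rule sets_PiM_I_finite)
    ultimately have "emeasure (distr ?P ?P ?T) (Pi\<^sub>E I A) = (\<Prod>i\<in>I. emeasure M {y. u i + y \<in> A i})"
      by (simp only: emeasure_distr[OF T])
    also have "\<dots> = (\<Prod>i\<in>I. emeasure M (A i))"
      using A by (intro prod.cong emeasure_translate) auto
    finally show "emeasure (distr ?P ?P ?T) (Pi\<^sub>E I A) = (\<Prod>i\<in>I. emeasure M (A i))" .
  qed simp
  then show ?thesis
    using integral_distr[OF T g] by simp
qed

text \<open>After taking powers, Fubini's theorem lets \<open>s\<close> be integrated first for
  fixed \<open>y\<close>; translation invariance makes that integral \<open>pnorm P g ^ P\<close>.
  Continuity in \<open>s\<close> follows from that of translations of \<open>g\<close>, as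
  \<open>f\<close> is bounded.\<close>

lemma pnorm_convolution:
  assumes f: "continuous_on UNIV f" and g: "continuous_on UNIV g" and P: "0 < P"
  shows "continuous_on UNIV (\<lambda>s. pnorm P (\<lambda>y. f y * g (y + s)))"
    and "pnorm P (\<lambda>s. pnorm P (\<lambda>y. f y * g (y + s))) = pnorm P f * pnorm P g"
proof -
  let ?k = "\<lambda>s y. f y * g (y + s)"
  let ?h = "\<lambda>s. pnorm P (?k s)"
  have k: "continuous_on UNIV (?k s)" for s
    by (intro continuous_on_mult f continuous_translate g)
  obtain A where A: "A > 0" "\<And>x. \<bar>f x\<bar> \<le> A"
    using continuous_bounded[OF f] by blast
  obtain B where B: "B > 0" "\<And>x. \<bar>g x\<bar> \<le> B"
    using continuous_bounded[OF g] by blast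
  have le: "?h s \<le> ?h t + A * c" if c: "\<And>y. \<bar>g (y + s) - g (y + t)\<bar> \<le> c" for s t c
  proof -
    have "pnorm P (\<lambda>y. ?k s y - ?k t y) \<le> A * c"
    proof (rule pnorm_bounded[OF _ _ P])
      show "(\<lambda>y. ?k s y - ?k t y) \<in> borel_measurable M"
        by (intro continuous_measurable continuous_on_diff k)
      show "\<bar>?k s y - ?k t y\<bar> \<le> A * c" for y
        unfolding right_diff_distrib[symmetric] abs_mult using A c by (intro mult_mono) auto
    qed
    then show ?thesis
      using pnorm_le_add_diff[OF continuous_Lp[OF k] continuous_Lp[OF k] P, of s t] by linarith
  qed
  have "(?h \<longlongrightarrow> ?h t) (at t)" for t
  proof (rule tendstoI)
    fix e :: real assume "0 < e"
    then have pos: "0 < e / (2 * A)"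
      using A by simp
    obtain U where U: "open U" "t \<in> U" "\<And>s y. s \<in> U \<Longrightarrow> \<bar>g (y + s) - g (y + t)\<bar> < e / (2 * A)"
      using uniform_translate[OF g pos, of t] by blast
    have "dist (?h s) (?h t) < e" if "s \<in> U" for s
    proof -
      have 1: "\<bar>g (y + s) - g (y + t)\<bar> \<le> e / (2 * A)" "\<bar>g (y + t) - g (y + s)\<bar> \<le> e / (2 * A)" for y
        using U(3)[OF that, of y] by linarith+
      have "?h s \<le> ?h t + A * (e / (2 * A))" "?h t \<le> ?h s + A * (e / (2 * A))"
        by (rule le, rule 1)+
      moreover have "A * (e / (2 * A)) = e / 2"
        using A by simp
      ultimately show ?thesis
        using \<open>0 < e\<close> unfolding dist_real_def by linarith
    qed
    then show "\<forall>\<^sub>F s in at t. dist (?h s) (?h t) < e"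
      using U(1,2) by (auto simp: eventually_at_topological)
  qed
  then show cont: "continuous_on UNIV ?h"
    by (simp add: continuous_on_def)
  interpret MM: pair_prob_space M M
    by unfold_locales
  have fm[measurable]: "f \<in> borel_measurable M" and gm[measurable]: "g \<in> borel_measurable M"
    using f g by (auto intro: continuous_measurable)
  have [measurable]: "(\<lambda>p. g (snd p + fst p)) \<in> borel_measurable (M \<Otimes>\<^sub>M M)"
    using plus_measurable_pair[OF g] by (simp add: case_prod_beta)
  have m: "(\<lambda>p. \<bar>?k (fst p) (snd p)\<bar> ^ P) \<in> borel_measurable (M \<Otimes>\<^sub>M M)"
    by measurable
  have "integrable (M \<Otimes>\<^sub>M M) (\<lambda>p. \<bar>?k (fst p) (snd p)\<bar> ^ P)"
  proof (rule MM.integrable_const_bound[of _ "(A * B) ^ P"])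
    show "AE p in M \<Otimes>\<^sub>M M. norm (\<bar>?k (fst p) (snd p)\<bar> ^ P) \<le> (A * B) ^ P"
      using A B by (intro AE_I2) (auto simp: abs_mult intro!: power_mono mult_mono)
  qed (rule m)
  then have I: "integrable (M \<Otimes>\<^sub>M M) (\<lambda>(s, y). \<bar>?k s y\<bar> ^ P)"
    by (simp add: case_prod_unfold)
  have "pnorm P ?h ^ P = (\<integral>s. (\<integral>y. \<bar>?k s y\<bar> ^ P \<partial>M) \<partial>M)"
    by (simp add: pnorm_power[OF P] pnorm_nonneg[OF P])
  also have "\<dots> = (\<integral>y. (\<integral>s. \<bar>?k s y\<bar> ^ P \<partial>M) \<partial>M)"
    using MM.Fubini_integral[OF I] by simp
  also have "\<dots> = (\<integral>y. \<bar>f y\<bar> ^ P * pnorm P g ^ P \<partial>M)"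
    by (simp add: abs_mult power_mult_distrib pnorm_power[OF P, symmetric] pnorm_translate[OF gm])
  also have "\<dots> = (pnorm P f * pnorm P g) ^ P"
    by (simp add: pnorm_power[OF P] power_mult_distrib)
  finally show "pnorm P ?h = pnorm P f * pnorm P g"
    using P by (simp add: power_eq_iff_eq_base pnorm_nonneg)
qed

end

context cubic_algebra
begin

text \<open>Continuous tuples \<open>F n\<close> approach \<open>f\<close> at a geometric rate. The
  product of \<open>F 0\<close> carries the main weight, and the consecutive differences add a
  series of small total weight.\<close>

lemma A_bound_cubic_conv_Lp:
  assumes f: "\<And>e. e \<in> cube_nz d \<Longrightarrow> f e \<in> Lp P" and \<epsilon>: "0 < \<epsilon>"
  shows "A_bound (cubic_conv M d f) (A_weight M d f + \<epsilon>)"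
proof -
  let ?N = "card (cube_nz d)"
  \<comment> \<open>A common bound for the approximating entries: they are within \<delta> of
    \<open>f e\<close> in norm, and \<delta> will be less than 1.\<close>
  define K where "K = 1 + (\<Sum>e\<in>cube_nz d. pnorm P (f e))"
  have fK: "pnorm P (f e) + 1 \<le> K" if "e \<in> cube_nz d" for e
    using member_le_sum[OF that, of "\<lambda>e. pnorm P (f e)"] by (simp add: K_def pnorm_nonneg)
  have K: "1 \<le> K"
    by (simp add: K_def sum_nonneg pnorm_nonneg)
  \<comment> \<open>The first term bounds the weight of \<open>F 0\<close>. In the second,
    \<open>2 * \<delta>\<close> arises from comparing consecutive approximations through
    \<open>f\<close>, and the last factor 2 is the sum of all \<open>(1 / 2) ^ n\<close>.\<close>
  let ?\<phi> = "\<lambda>\<delta>. (\<Prod>e\<in>cube_nz d. pnorm P (f e) + \<delta>) + ?N * (2 * \<delta> * K ^ ?N) * 2"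
  have "(?\<phi> \<longlongrightarrow> (\<Prod>e\<in>cube_nz d. pnorm P (f e) + 0) + ?N * (2 * 0 * K ^ ?N) * 2) (at_right 0)"
    by (intro tendsto_intros)
  then have "\<forall>\<^sub>F \<delta> in at_right 0. ?\<phi> \<delta> < A_weight M d f + \<epsilon>"
    using \<epsilon> by (intro order_tendstoD(2)) (auto simp: A_weight_eq)
  moreover have "\<forall>\<^sub>F \<delta> in at_right 0. \<delta> \<in> {0<..<1::real}"
    by (rule eventually_at_right_real) simp
  ultimately have "\<forall>\<^sub>F \<delta> in at_right 0. ?\<phi> \<delta> < A_weight M d f + \<epsilon> \<and> \<delta> \<in> {0<..<1}"
    by eventually_elim auto
  then obtain \<delta> where \<delta>: "?\<phi> \<delta> < A_weight M d f + \<epsilon>" "0 < \<delta>" "\<delta> < 1"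
    using eventually_happens'[OF trivial_limit_at_right_real[of "0::real"]] by fastforce
  define \<delta>n where "\<delta>n n = \<delta> * (1 / 2) ^ n" for n :: nat
  have \<delta>n: "0 < \<delta>n n" "\<delta>n n \<le> \<delta>" "\<delta>n n \<le> (1 / 2) ^ n" "\<delta>n (Suc n) \<le> \<delta>n n" for n
    using \<delta>(2,3) mult_left_le[of "(1 / 2) ^ n" \<delta>] mult_right_le_one_le[of "(1 / 2) ^ n" \<delta>]
      mult_left_le_one_le[of "(1 / 2) ^ n" \<delta>]
    by (auto simp: \<delta>n_def power_le_one)
  have "\<exists>c. continuous_on UNIV c \<and> pnorm P (\<lambda>x. f e x - c x) < \<delta>n n" if "e \<in> cube_nz d" for e n
    using continuous_dense_Lp[OF f[OF that] P_pos \<delta>n(1)[of n]] by blast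
  then have "\<forall>p. \<exists>c. fst p \<in> cube_nz d \<longrightarrow> continuous_on UNIV c \<and> pnorm P (\<lambda>x. f (fst p) x - c x) < \<delta>n (snd p)"
    by blast
  from choice[OF this] obtain C where C: "\<forall>p. fst p \<in> cube_nz d \<longrightarrow>
      continuous_on UNIV (C p) \<and> pnorm P (\<lambda>x. f (fst p) x - C p x) < \<delta>n (snd p)" ..
  define F where "F n e = C (e, n)" for n e
  have F: "continuous_on UNIV (F n e)" "pnorm P (\<lambda>x. f e x - F n e x) \<le> \<delta>n n" if "e \<in> cube_nz d" for n e
    using C[rule_format, of "(e, n)"] that by (auto simp: F_def)
  have FL: "F n e \<in> Lp P" if "e \<in> cube_nz d" for n e
    by (rule continuous_Lp[OF F(1)[OF that]])
  have tup: "continuous_tuple (F n)" for n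
    using F(1) by (simp add: continuous_tuple_def)
  have F_le: "pnorm P (F n e) \<le> pnorm P (f e) + \<delta>" if "e \<in> cube_nz d" for n e
    using pnorm_le_add_diff[OF FL[OF that] f[OF that] P_pos, of n] F(2)[OF that, of n] \<delta>n(2)[of n]
      pnorm_minus_commute[of P "f e" "F n e"] by linarith
  have F_K: "pnorm P (F n e) \<le> K" if "e \<in> cube_nz d" for n e
    using F_le[OF that, of n] fK[OF that] \<delta>(3) by linarith
  have F_diff: "pnorm P (\<lambda>x. F (Suc n) e x - F n e x) \<le> 2 * \<delta>n n" if "e \<in> cube_nz d" for n e
    using pnorm_diff_triangle[OF FL[OF that] f[OF that] FL[OF that] P_pos, of "Suc n" n] F(2)[OF that, of n]
      F(2)[OF that, of "Suc n"] \<delta>n(4)[of n] pnorm_minus_commute[of P "f e" "F (Suc n) e"] by linarith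
  let ?s = "\<lambda>n. ?N * (2 * \<delta>n n * K ^ ?N)"
  have "(\<lambda>n. (1 / 2) ^ n) sums (2::real)"
    using geometric_sums[of "1 / 2 :: real"] by simp
  then have "(\<lambda>n. (?N * (2 * \<delta> * K ^ ?N)) * (1 / 2) ^ n) sums ((?N * (2 * \<delta> * K ^ ?N)) * 2)"
    by (rule sums_mult)
  then have s: "?s sums (?N * (2 * \<delta> * K ^ ?N) * 2)"
    by (simp add: \<delta>n_def mult_ac)
  note diff = A_bound_cubic_conv_diff[OF tup tup K F_K F_K F_diff]
  have "A_bound (cubic_conv M d f) (A_weight M d (F 0) + (\<Sum>n. ?s n))"
  proof (rule A_bound_LIMSEQ)
    show "A_bound (cubic_conv M d (F 0)) (A_weight M d (F 0))"
      by (rule A_bound_cubic_conv[OF tup])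
    show "A_bound (\<lambda>x. cubic_conv M d (F (Suc n)) x - cubic_conv M d (F n) x) (?s n)" for n
      by (rule diff(1))
    show "summable ?s"
      using s by (rule sums_summable)
    \<comment> \<open>Convergence is needed at every point. For each fixed \<open>x\<close> the
      exceptional null set of an entry is avoided by \<open>x + cube_dot d e t\<close> for almost
      every \<open>t\<close>.\<close>
    fix x :: 'a
    let ?p = "\<lambda>f t. \<Prod>e\<in>cube_nz d. f e (x + cube_dot d e t)"
    have "AE t in Q. (\<lambda>n. F n e (x + cube_dot d e t)) \<longlonglongrightarrow> f e (x + cube_dot d e t)" if "e \<in> cube_nz d" for e
    proof -
      have AE: "AE y in M. (\<lambda>n. F n e y) \<longlonglongrightarrow> f e y"
        by (rule AE_LIMSEQ_of_pnorm[OF f[OF that] FL[OF that] P_pos order_trans[OF F(2)[OF that] \<delta>n(3)]])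
      obtain N where N: "N \<in> null_sets M" "\<And>y. y \<in> space M - N \<Longrightarrow> (\<lambda>n. F n e y) \<longlonglongrightarrow> f e y"
        using AE_E3[OF AE] by blast
      from AE_cube_dot_not_null[OF N(1) that, of x] show ?thesis
        by eventually_elim (simp add: N(2))
    qed
    then have "AE t in Q. \<forall>e\<in>cube_nz d. (\<lambda>n. F n e (x + cube_dot d e t)) \<longlonglongrightarrow> f e (x + cube_dot d e t)"
      by (intro AE_finite_allI) auto
    then have "AE t in Q. (\<lambda>n. ?p (F n) t) \<longlonglongrightarrow> ?p f t"
      by eventually_elim (auto intro: tendsto_prod)
    then have "(\<lambda>n. \<integral>t. ?p (F n) t \<partial>Q) \<longlonglongrightarrow> (\<integral>t. ?p f t \<partial>completion Q)"
      using integral_telescope_completion[where N = Q and p = "\<lambda>n. ?p (F n)" and q = "?p f",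
          OF continuous_tuple_integrable[OF tup] sums_summable[OF s] diff(2)]
      by blast
    then show "(\<lambda>n. cubic_conv M d (F n) x) \<longlonglongrightarrow> cubic_conv M d f x"
      unfolding cubic_conv_continuous[OF tup] by (simp add: cubic_conv_def)
  qed
  moreover have "A_weight M d (F 0) \<le> (\<Prod>e\<in>cube_nz d. pnorm P (f e) + \<delta>)"
    unfolding A_weight_eq using F_le by (intro prod_mono) (auto simp: pnorm_nonneg)
  ultimately show ?thesis
    using \<delta>(1) sums_unique[OF s] by (elim A_bound_mono) linarith
qed

end

section \<open>Products of cubic convolution products\<close>

context cubic_algebra
begin

lemma abs_integral_Q_le:
  fixes \<phi> :: "(nat \<Rightarrow> 'a) \<Rightarrow> real"
  assumes "integrable Q \<phi>" "\<And>t. \<bar>\<phi> t\<bar> \<le> c"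
  shows "\<bar>\<integral>t. \<phi> t \<partial>Q\<bar> \<le> c"
proof -
  have "(\<integral>t. \<bar>\<phi> t\<bar> \<partial>Q) \<le> c"
    by (rule Q.integral_le_const[OF integrable_abs[OF assms(1)]]) (simp add: assms(2))
  then show ?thesis
    using integral_abs_bound[of Q \<phi>] by linarith
qed

text \<open>\<open>G n\<close> averages the cubic convolution products of \<open>F t\<close> over a
  rounded parameter \<open>t\<close>, so it is a finite average. Consecutive \<open>G n\<close> are
  compared tuple by tuple, while the weights in \<open>G 0\<close> are compared with those at the
  unrounded \<open>t\<close>, where the formula for norms of shifted products applies.\<close>

lemma A_bound_mult_cubic_conv:
  assumes f: "continuous_tuple f" and g: "continuous_tuple g" and \<epsilon>: "0 < \<epsilon>"
  shows "A_bound (\<lambda>x. cubic_conv M d f x * cubic_conv M d g x) (A_weight M d f * A_weight M d g + \<epsilon>)"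
proof -
  let ?N = "card (cube_nz d)"
  have fc: "continuous_on UNIV (f e)" and gc: "continuous_on UNIV (g e)" if "e \<in> cube_nz d" for e
    using f g that by (auto simp: continuous_tuple_def)
  have "\<exists>c. \<forall>y. \<bar>f e y\<bar> \<le> c \<and> \<bar>g e y\<bar> \<le> c" if e: "e \<in> cube_nz d" for e
  proof -
    obtain a where "\<And>y. \<bar>f e y\<bar> \<le> a"
      using continuous_bounded[OF fc[OF e]] by blast
    moreover obtain b where "\<And>y. \<bar>g e y\<bar> \<le> b"
      using continuous_bounded[OF gc[OF e]] by blast
    ultimately show ?thesis
      by (intro exI[of _ "max a b"]) (auto simp: le_max_iff_disj)
  qed
  then obtain c where c: "\<And>e y. e \<in> cube_nz d \<Longrightarrow> \<bar>f e y\<bar> \<le> c e \<and> \<bar>g e y\<bar> \<le> c e"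
    by metis
  define C where "C = 1 + (\<Sum>e\<in>cube_nz d. \<bar>c e\<bar>)"
  have C1: "1 \<le> C"
    by (simp add: C_def sum_nonneg)
  have C: "\<bar>f e y\<bar> \<le> C" "\<bar>g e y\<bar> \<le> C" if "e \<in> cube_nz d" for e y
    using c[OF that, of y] member_le_sum[OF that, of "\<lambda>e. \<bar>c e\<bar>"] abs_ge_self[of "c e"]
    unfolding C_def by (simp_all del: abs_ge_self)
  define K where "K = C * C"
  have K: "1 \<le> K" "C \<le> K"
    using C1 mult_mono[of 1 C 1 C] mult_left_mono[of 1 C C] by (auto simp: K_def)
  \<comment> \<open>The factor 5 counts errors in units of
    \<open>\<delta> * (?N * (C * K ^ ?N))\<close>: one from rounding \<open>t\<close> in the weights
    of \<open>G 0\<close>, and four from the consecutive differences, which contribute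
    \<open>2 * \<delta>n n\<close> each and whose geometric sum doubles this. Adding 1 makes
    \<open>D\<close> positive.\<close>
  define D where "D = 5 * (?N * (C * K ^ ?N)) + 1"
  have D: "0 < D"
    using C1 K by (simp add: D_def add_nonneg_pos)
  define \<delta> where "\<delta> = \<epsilon> / D"
  have \<delta>: "0 < \<delta>"
    using \<epsilon> D by (simp add: \<delta>_def)
  define \<delta>n where "\<delta>n n = \<delta> * (1 / 2) ^ n" for n :: nat
  have \<delta>n: "0 < \<delta>n n" "\<delta>n (Suc n) \<le> \<delta>n n" for n
    using \<delta> by (auto simp: \<delta>n_def)
  define F where "F s e = (\<lambda>y. f e y * g e (y + cube_dot d e s))" for s e
  have Fc: "continuous_on UNIV (F s e)" if "e \<in> cube_nz d" for s e
    unfolding F_def using that by (intro continuous_on_mult continuous_translate fc gc)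
  then have tup: "continuous_tuple (F s)" for s
    by (simp add: continuous_tuple_def)
  have FK: "pnorm P (F s e) \<le> K" if "e \<in> cube_nz d" for s e
  proof (rule pnorm_bounded[OF continuous_measurable[OF Fc[OF that]] _ P_pos])
    show "\<bar>F s e y\<bar> \<le> K" for y
      unfolding F_def K_def abs_mult using C[OF that] C1 by (intro mult_mono) auto
  qed
  have F_diff: "pnorm P (\<lambda>y. F s e y - F s' e y) \<le> C * b"
    if e: "e \<in> cube_nz d" and b: "\<And>y. \<bar>g e (y + cube_dot d e s) - g e (y + cube_dot d e s')\<bar> \<le> b" for s s' e b
  proof (rule pnorm_bounded[OF _ _ P_pos])
    show "(\<lambda>y. F s e y - F s' e y) \<in> borel_measurable M"
      by (intro continuous_measurable continuous_on_diff Fc e)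
    show "\<bar>F s e y - F s' e y\<bar> \<le> C * b" for y
      unfolding F_def right_diff_distrib[symmetric] abs_mult using C[OF e] C1 b by (intro mult_mono) auto
  qed
  have dR: "0 < real d"
    using d_pos by simp
  have pos: "0 < \<delta>n n / d" for n
    using \<delta>n(1) dR by simp
  have Hc: "continuous_on UNIV k" if "k \<in> g ` cube_nz d" for k
    using gc that by blast
  \<comment> \<open>Rounding all coordinates of \<open>t\<close> multiplies the error by
    \<open>d\<close>, hence the tolerance \<open>\<delta>n n / d\<close> for a single
    translation.\<close>
  obtain \<tau> where \<tau>: "\<And>n. simple_function M (\<tau> n)"
    "\<And>n k t y. k \<in> g ` cube_nz d \<Longrightarrow> \<bar>k (y + t) - k (y + \<tau> n t)\<bar> \<le> \<delta>n n / d"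
    by (rule simple_translate_sequence[of "g ` cube_nz d" "\<lambda>n. \<delta>n n / d", OF finite_imageI[OF finite_cube_nz] Hc pos])
      (assumption, rule that)
  define \<sigma> where "\<sigma> n t = (\<lambda>i\<in>{..<d}. \<tau> n (t i))" for n and t :: "nat \<Rightarrow> 'a"
  have \<sigma>: "simple_function Q (\<sigma> n)" for n
    unfolding \<sigma>_def
  proof (rule simple_function_restrict)
    fix i assume "i \<in> {..<d}"
    then have "(\<lambda>t. t i) \<in> Q \<rightarrow>\<^sub>M M"
      by (rule measurable_component_singleton)
    then show "simple_function Q (\<lambda>t. \<tau> n (t i))"
      by (rule simple_function_comp) (rule \<tau>(1))
  qed simp
  have g\<sigma>: "\<bar>g e (y + cube_dot d e t) - g e (y + cube_dot d e (\<sigma> n t))\<bar> \<le> \<delta>n n" if "e \<in> cube_nz d" for e y n t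
  proof -
    have "cube_dot d e (\<sigma> n t) = cube_dot d e (\<lambda>i. \<tau> n (t i))"
      by (rule cube_dot_cong) (simp add: \<sigma>_def)
    moreover have "\<bar>g e (y + cube_dot d e t) - g e (y + cube_dot d e (\<lambda>i. \<tau> n (t i)))\<bar> \<le> d * (\<delta>n n / d)"
      by (rule cube_dot_approx) (use \<tau>(2) that in blast)
    ultimately show ?thesis
      using dR by simp
  qed
  define G where "G n x = (\<integral>t. cubic_conv M d (F (\<sigma> n t)) x \<partial>Q)" for n x
  let ?s = "\<lambda>n. ?N * (C * (2 * \<delta>n n) * K ^ ?N)"
  have G0: "A_bound (G 0) (\<integral>t. A_weight M d (F (\<sigma> 0 t)) \<partial>Q)"
    unfolding G_def
    by (rule A_bound_integral_simple[OF Q.finite_measure_axioms \<sigma>]) (rule A_bound_cubic_conv[OF tup])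
  have G_diff: "A_bound (\<lambda>x. G (Suc n) x - G n x) (?s n)" for n
  proof -
    let ?\<Phi> = "\<lambda>p x. cubic_conv M d (F (fst p)) x - cubic_conv M d (F (snd p)) x"
    have pair: "simple_function Q (\<lambda>t. (\<sigma> (Suc n) t, \<sigma> n t))"
      by (intro simple_function_Pair \<sigma>)
    have "A_bound (\<lambda>x. \<integral>t. ?\<Phi> (\<sigma> (Suc n) t, \<sigma> n t) x \<partial>Q) (\<integral>t. (\<lambda>p. ?s n) (\<sigma> (Suc n) t, \<sigma> n t) \<partial>Q)"
    proof (rule A_bound_integral_simple[OF Q.finite_measure_axioms pair])
      fix t
      \<comment> \<open>Both rounded points are compared with \<open>t\<close> itself, which
        accounts for the factor 2.\<close>
      have "pnorm P (\<lambda>y. F (\<sigma> (Suc n) t) e y - F (\<sigma> n t) e y) \<le> C * (2 * \<delta>n n)" if e: "e \<in> cube_nz d" for e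
      proof (rule F_diff[OF e])
        show "\<bar>g e (y + cube_dot d e (\<sigma> (Suc n) t)) - g e (y + cube_dot d e (\<sigma> n t))\<bar> \<le> 2 * \<delta>n n" for y
          using g\<sigma>[OF e, of y t n] g\<sigma>[OF e, of y t "Suc n"] \<delta>n(2)[of n] by linarith
      qed
      then show "A_bound (?\<Phi> (\<sigma> (Suc n) t, \<sigma> n t)) ((\<lambda>p. ?s n) (\<sigma> (Suc n) t, \<sigma> n t))"
        unfolding fst_conv snd_conv by (intro A_bound_cubic_conv_diff(1) tup K FK)
    qed
    moreover have "(\<integral>t. ?\<Phi> (\<sigma> (Suc n) t, \<sigma> n t) x \<partial>Q) = G (Suc n) x - G n x" for x
      unfolding G_def fst_conv snd_conv
      by (intro Bochner_Integration.integral_diff integral_simple_function_comp(1)[OF Q.finite_measure_axioms \<sigma>])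
    ultimately show ?thesis
      by (simp add: Q.prob_space)
  qed
  have lim: "(\<lambda>n. G n x) \<longlonglongrightarrow> cubic_conv M d f x * cubic_conv M d g x" for x
  proof (rule LIMSEQ_abs_le)
    fix n
    define a where "a u = (\<Prod>e\<in>cube_nz d. f e (x + cube_dot d e u))" for u
    define b where "b u t = (\<Prod>e\<in>cube_nz d. g e (x + cube_dot d e u + cube_dot d e t))" for u t
    have aI: "integrable Q a"
      unfolding a_def by (rule continuous_tuple_integrable[OF f])
    have bI: "integrable Q (b u)" for u
    proof -
      have "continuous_tuple (\<lambda>e y. g e (y + cube_dot d e u))"
        using gc by (auto simp: continuous_tuple_def intro: continuous_translate)
      from continuous_tuple_integrable[OF this, of x] show ?thesis
        by (simp add: b_def[abs_def] ac_simps)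
    qed
    have F_eq: "(\<Prod>e\<in>cube_nz d. F s e (x + cube_dot d e u)) = a u * b u s" for s u
      by (simp add: F_def a_def b_def prod.distrib)
    have abI: "integrable Q (\<lambda>u. a u * b u s)" for s
      using continuous_tuple_integrable[OF tup, of s x] by (simp add: F_eq)
    have "G n x = (\<integral>t. (\<integral>u. a u * b u (\<sigma> n t) \<partial>Q) \<partial>Q)"
      unfolding G_def cubic_conv_continuous[OF tup] F_eq ..
    also have "\<dots> = (\<integral>u. (\<integral>t. a u * b u (\<sigma> n t) \<partial>Q) \<partial>Q)"
      by (rule integral_simple_swap(1)[OF Q.finite_measure_axioms \<sigma> abI])
    finally have Gn: "G n x = (\<integral>u. (\<integral>t. a u * b u (\<sigma> n t) \<partial>Q) \<partial>Q)" .
    \<comment> \<open>The substitution of \<open>u + t\<close> for the second variable: invariance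
      of \<open>Q\<close> makes the mean of \<open>b u\<close> independent of \<open>u\<close>, so
      \<open>cubic_conv M d g x\<close> can be moved under the integral over
      \<open>u\<close>.\<close>
    have conv_g: "cubic_conv M d g x = (\<integral>t. b u t \<partial>Q)" for u
    proof -
      let ?q = "\<lambda>t. \<Prod>e\<in>cube_nz d. g e (x + cube_dot d e t)"
      have "cube_dot d e (\<lambda>i\<in>{..<d}. u i + t i) = cube_dot d e u + cube_dot d e t" for e t
        unfolding cube_dot_add[symmetric] by (rule cube_dot_cong) simp
      then have "?q (\<lambda>i\<in>{..<d}. u i + t i) = b u t" for t
        by (simp add: b_def add.assoc)
      moreover have "(\<integral>t. ?q (\<lambda>i\<in>{..<d}. u i + t i) \<partial>Q) = (\<integral>t. ?q t \<partial>Q)"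
        by (rule integral_PiM_translate) (use continuous_tuple_integrable[OF g] in auto)
      ultimately show ?thesis
        by (simp add: cubic_conv_continuous[OF g])
    qed
    have b_diff: "\<bar>b u t - b u (\<sigma> n t)\<bar> \<le> ?N * (\<delta>n n * K ^ ?N)" for u t
      unfolding b_def
      by (rule abs_prod_diff_le[OF finite_cube_nz K(1)]) (auto intro: g\<sigma> order_trans[OF C(2) K(2)])
    have a_le: "\<bar>a u\<bar> \<le> K ^ ?N" for u
    proof -
      have "\<bar>a u\<bar> \<le> (\<Prod>e\<in>cube_nz d. K)"
        unfolding a_def abs_prod by (intro prod_mono) (auto intro: order_trans[OF C(1) K(2)])
      then show ?thesis by simp
    qed
    have "cubic_conv M d f x * cubic_conv M d g x - G n x =
      (\<integral>u. a u * cubic_conv M d g x \<partial>Q) - (\<integral>u. (\<integral>t. a u * b u (\<sigma> n t) \<partial>Q) \<partial>Q)"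
      unfolding Gn by (simp add: cubic_conv_continuous[OF f] a_def)
    also have "\<dots> = (\<integral>u. a u * cubic_conv M d g x - (\<integral>t. a u * b u (\<sigma> n t) \<partial>Q) \<partial>Q)"
      by (intro Bochner_Integration.integral_diff[symmetric] integrable_mult_left aI
        integral_simple_swap(2)[OF Q.finite_measure_axioms \<sigma> abI])
    also have "\<bar>\<dots>\<bar> \<le> K ^ ?N * (?N * (\<delta>n n * K ^ ?N))"
    proof (rule abs_integral_Q_le)
      show "integrable Q (\<lambda>u. a u * cubic_conv M d g x - (\<integral>t. a u * b u (\<sigma> n t) \<partial>Q))"
        by (intro Bochner_Integration.integrable_diff integrable_mult_left aI
          integral_simple_swap(2)[OF Q.finite_measure_axioms \<sigma> abI])
      fix u
      have I: "integrable Q (\<lambda>t. b u (\<sigma> n t))"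
        by (rule integral_simple_function_comp(1)[OF Q.finite_measure_axioms \<sigma>])
      have "a u * cubic_conv M d g x - (\<integral>t. a u * b u (\<sigma> n t) \<partial>Q) = a u * (\<integral>t. b u t - b u (\<sigma> n t) \<partial>Q)"
        using I bI[of u] by (simp add: conv_g[of u] right_diff_distrib)
      also have "\<bar>\<dots>\<bar> \<le> K ^ ?N * (?N * (\<delta>n n * K ^ ?N))"
        unfolding abs_mult using I bI[of u] a_le b_diff K(1)
        by (intro mult_mono abs_integral_Q_le Bochner_Integration.integrable_diff) auto
      finally show "\<bar>a u * cubic_conv M d g x - (\<integral>t. a u * b u (\<sigma> n t) \<partial>Q)\<bar> \<le> K ^ ?N * (?N * (\<delta>n n * K ^ ?N))" .
    qed
    finally show "\<bar>cubic_conv M d f x * cubic_conv M d g x - G n x\<bar> \<le> (K ^ ?N * (?N * (\<delta> * K ^ ?N))) * (1 / 2) ^ n"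
      by (simp add: \<delta>n_def mult_ac)
  qed
  \<comment> \<open>With the functions \<open>?h e\<close> as entries, the weight of
    \<open>F t\<close> is the integrand of a cubic convolution product at the point 0, so the cube
    integral bound applies to it. The added term is the cost of rounding \<open>t\<close> to
    \<open>\<sigma> 0 t\<close>.\<close>
  have start: "(\<integral>t. A_weight M d (F (\<sigma> 0 t)) \<partial>Q) \<le> A_weight M d f * A_weight M d g + ?N * (C * \<delta> * K ^ ?N)"
  proof -
    let ?h = "\<lambda>e s. pnorm P (\<lambda>y. f e y * g e (y + s))"
    have h: "continuous_on UNIV (?h e)" "pnorm P (?h e) = pnorm P (f e) * pnorm P (g e)" if "e \<in> cube_nz d" for e
      using pnorm_convolution[OF fc[OF that] gc[OF that] P_pos] .
    have w: "A_weight M d (F t) = (\<Prod>e\<in>cube_nz d. ?h e (0 + cube_dot d e t))" for t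
      by (simp add: A_weight_eq F_def)
    have wI: "integrable Q (\<lambda>t. A_weight M d (F t))"
      unfolding w by (rule continuous_cube_integral(1)[OF h(1)])
    have "(\<integral>t. A_weight M d (F t) \<partial>Q) = (\<integral>t. \<bar>A_weight M d (F t)\<bar> \<partial>Q)"
      by (simp add: A_weight_nonneg)
    also have "\<dots> \<le> (\<Prod>e\<in>cube_nz d. pnorm P (?h e))"
      unfolding w by (rule continuous_cube_integral(2)[OF h(1)])
    also have "\<dots> = A_weight M d f * A_weight M d g"
      unfolding A_weight_eq prod.distrib[symmetric] by (rule prod.cong[OF refl h(2)])
    finally have 1: "(\<integral>t. A_weight M d (F t) \<partial>Q) \<le> A_weight M d f * A_weight M d g" .
    have "A_weight M d (F (\<sigma> 0 t)) \<le> A_weight M d (F t) + ?N * (C * \<delta> * K ^ ?N)" for t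
    proof -
      have "\<bar>A_weight M d (F (\<sigma> 0 t)) - A_weight M d (F t)\<bar> \<le> ?N * (C * \<delta> * K ^ ?N)"
        unfolding A_weight_eq
      proof (rule abs_prod_diff_le[OF finite_cube_nz K(1)])
        fix e assume e: "e \<in> cube_nz d"
        show "\<bar>pnorm P (F (\<sigma> 0 t) e)\<bar> \<le> K" "\<bar>pnorm P (F t e)\<bar> \<le> K"
          using FK[OF e] by (simp_all add: pnorm_nonneg)
        have b: "\<bar>g e (y + cube_dot d e t) - g e (y + cube_dot d e (\<sigma> 0 t))\<bar> \<le> \<delta>" for y
          using g\<sigma>[OF e, of y t 0] by (simp add: \<delta>n_def)
        have "pnorm P (\<lambda>y. F t e y - F (\<sigma> 0 t) e y) \<le> C * \<delta>"
          by (rule F_diff[OF e b])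
        then show "\<bar>pnorm P (F (\<sigma> 0 t) e) - pnorm P (F t e)\<bar> \<le> C * \<delta>"
          using pnorm_le_add_diff[OF continuous_Lp[OF Fc[OF e]] continuous_Lp[OF Fc[OF e]] P_pos, of t "\<sigma> 0 t"]
            pnorm_le_add_diff[OF continuous_Lp[OF Fc[OF e]] continuous_Lp[OF Fc[OF e]] P_pos, of "\<sigma> 0 t" t]
            pnorm_minus_commute[of P "F t e" "F (\<sigma> 0 t) e"] by linarith
      qed
      then show ?thesis by linarith
    qed
    then have "(\<integral>t. A_weight M d (F (\<sigma> 0 t)) \<partial>Q) \<le> (\<integral>t. A_weight M d (F t) + ?N * (C * \<delta> * K ^ ?N) \<partial>Q)"
      using wI by (intro integral_mono integral_simple_function_comp(1)[OF Q.finite_measure_axioms \<sigma>]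
        Bochner_Integration.integrable_add) auto
    also have "\<dots> = (\<integral>t. A_weight M d (F t) \<partial>Q) + ?N * (C * \<delta> * K ^ ?N)"
      using wI by (simp add: Q.prob_space)
    finally show ?thesis
      using 1 by linarith
  qed
  have "(\<lambda>n. (1 / 2) ^ n) sums (2::real)"
    using geometric_sums[of "1 / 2 :: real"] by simp
  then have "(\<lambda>n. (?N * (C * (2 * \<delta>) * K ^ ?N)) * (1 / 2) ^ n) sums ((?N * (C * (2 * \<delta>) * K ^ ?N)) * 2)"
    by (rule sums_mult)
  then have s: "?s sums (?N * (C * (2 * \<delta>) * K ^ ?N) * 2)"
    by (simp add: \<delta>n_def mult_ac)
  have "A_bound (\<lambda>x. cubic_conv M d f x * cubic_conv M d g x)
    ((\<integral>t. A_weight M d (F (\<sigma> 0 t)) \<partial>Q) + (\<Sum>n. ?s n))"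
    by (rule A_bound_LIMSEQ[OF G0 G_diff sums_summable[OF s] lim])
  moreover have "?N * (C * \<delta> * K ^ ?N) + ?N * (C * (2 * \<delta>) * K ^ ?N) * 2 \<le> \<epsilon>"
  proof -
    have "?N * (C * \<delta> * K ^ ?N) + ?N * (C * (2 * \<delta>) * K ^ ?N) * 2 = (D - 1) * \<delta>"
      by (simp add: D_def algebra_simps)
    also have "\<dots> \<le> D * \<delta>"
      using \<delta> by (intro mult_right_mono) auto
    also have "\<dots> = \<epsilon>"
      using D by (simp add: \<delta>_def)
    finally show ?thesis .
  qed
  ultimately show ?thesis
    using start sums_unique[OF s] by (elim A_bound_mono) linarith
qed

text \<open>The two series multiply to a double series of products, enumerated by the pairing
  function. The \<open>n\<close>-th product may exceed its weight by
  \<open>\<epsilon> * (1 / 2) ^ Suc n\<close>, so the total excess is \<epsilon>.\<close>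

lemma A_bound_mult:
  assumes g: "A_bound g r" and h: "A_bound h s" and \<epsilon>: "0 < \<epsilon>"
  shows "A_bound (\<lambda>x. g x * h x) (r * s + \<epsilon>)"
proof -
  obtain a where a: "\<And>j. continuous_tuple (a j)" "summable (\<lambda>j. A_weight M d (a j))"
     "(\<Sum>j. A_weight M d (a j)) \<le> r" "\<And>x. (\<lambda>j. cubic_conv M d (a j) x) sums g x"
    using g unfolding A_bound_def by blast
  obtain b where b: "\<And>j. continuous_tuple (b j)" "summable (\<lambda>j. A_weight M d (b j))"
     "(\<Sum>j. A_weight M d (b j)) \<le> s" "\<And>x. (\<lambda>j. cubic_conv M d (b j) x) sums h x"
    using h unfolding A_bound_def by blast
  let ?A = "\<Sum>j. A_weight M d (a j)" and ?B = "\<Sum>j. A_weight M d (b j)"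
  let ?w = "\<lambda>j k. A_weight M d (a j) * A_weight M d (b k)"
  let ?v = "\<lambda>x j k. cubic_conv M d (a j) x * cubic_conv M d (b k) x"
  have w: "?w j sums (A_weight M d (a j) * ?B)" for j
    by (intro sums_mult summable_sums b)
  have ws: "summable (\<lambda>j. A_weight M d (a j) * ?B)"
    by (intro summable_mult2 a)
  have "(\<lambda>n. ?w (fst (prod_decode n)) (snd (prod_decode n))) sums (\<Sum>j. A_weight M d (a j) * ?B)"
    by (rule sums_prod_decode[OF w ws _ w]) (simp add: A_weight_nonneg)
  moreover have "(\<Sum>j. A_weight M d (a j) * ?B) = ?A * ?B"
    by (rule suminf_mult2[symmetric, OF a(2)])
  ultimately have W: "(\<lambda>n. ?w (fst (prod_decode n)) (snd (prod_decode n))) sums (?A * ?B)"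
    by simp
  have V: "(\<lambda>n. ?v x (fst (prod_decode n)) (snd (prod_decode n))) sums (g x * h x)" for x
  proof -
    have "(\<lambda>n. ?v x (fst (prod_decode n)) (snd (prod_decode n))) sums (\<Sum>j. cubic_conv M d (a j) x * h x)"
    proof (rule sums_prod_decode[OF w ws])
      show "\<bar>?v x j k\<bar> \<le> ?w j k" for j k
        unfolding abs_mult by (intro mult_mono abs_cubic_conv_le a b) (auto simp: A_weight_nonneg)
      show "?v x j sums (cubic_conv M d (a j) x * h x)" for j
        by (intro sums_mult b)
    qed
    moreover have "(\<Sum>j. cubic_conv M d (a j) x * h x) = g x * h x"
      using sums_unique[OF sums_mult2[OF a(4)]] by simp
    ultimately show ?thesis by simp
  qed
  have R: "(\<lambda>n. ?w (fst (prod_decode n)) (snd (prod_decode n)) + \<epsilon> * (1 / 2) ^ Suc n) sums (?A * ?B + \<epsilon>)"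
    by (intro sums_add W sums_half_powers)
  have "A_bound (\<lambda>x. \<Sum>n. ?v x (fst (prod_decode n)) (snd (prod_decode n)))
    (\<Sum>n. ?w (fst (prod_decode n)) (snd (prod_decode n)) + \<epsilon> * (1 / 2) ^ Suc n)"
    using \<epsilon> by (intro A_bound_suminf A_bound_mult_cubic_conv a b sums_summable[OF R]) auto
  then have "A_bound (\<lambda>x. g x * h x) (?A * ?B + \<epsilon>)"
    by (simp only: sums_unique[OF V, symmetric] sums_unique[OF R, symmetric])
  moreover have "?A * ?B \<le> r * s"
  proof (rule mult_mono[OF a(3) b(3)])
    show "0 \<le> ?B"
      by (rule suminf_nonneg[OF b(2) A_weight_nonneg])
    show "0 \<le> r"
      by (rule order_trans[OF suminf_nonneg[OF a(2) A_weight_nonneg] a(3)])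
  qed
  ultimately show ?thesis
    by (elim A_bound_mono) simp
qed

section \<open>From representations by continuous tuples to the norm\<close>

lemma bdd_below_A_norm: "bdd_below ((\<lambda>f. \<Sum>j. A_weight M d (f j)) ` {f. A_rep M d g f})"
  by (rule bdd_belowI[of _ 0]) (auto simp: A_rep_def intro!: suminf_nonneg A_weight_nonneg)

lemma A_bound_imp_A_space:
  assumes "A_bound g r"
  shows "g \<in> A_space M d" and "A_norm M d g \<le> r"
proof -
  obtain c where c: "\<And>j. continuous_tuple (c j)" "summable (\<lambda>j. A_weight M d (c j))"
     "(\<Sum>j. A_weight M d (c j)) \<le> r" "\<And>x. (\<lambda>j. cubic_conv M d (c j) x) sums g x"
    using assms unfolding A_bound_def by blast
  have rep: "A_rep M d g c"
    unfolding A_rep_def Lspace_eq_Lp using c by (auto simp: continuous_tuple_def intro: continuous_Lp)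
  then show "g \<in> A_space M d"
    by (auto simp: A_space_def)
  have "A_norm M d g \<le> (\<Sum>j. A_weight M d (c j))"
    unfolding A_norm_def by (rule cINF_lower[OF bdd_below_A_norm]) (simp add: rep)
  with c(3) show "A_norm M d g \<le> r"
    by linarith
qed

text \<open>Half of \<epsilon> pays for a representation close to the infimum; the other half,
  divided geometrically among its terms, pays for replacing each tuple by a series of continuous
  ones.\<close>

lemma A_space_imp_A_bound:
  assumes g: "g \<in> A_space M d" and \<epsilon>: "0 < \<epsilon>"
  shows "A_bound g (A_norm M d g + \<epsilon>)"
proof -
  have "A_norm M d g < A_norm M d g + \<epsilon> / 2"
    using \<epsilon> by simp
  then obtain f where f: "A_rep M d g f" "(\<Sum>j. A_weight M d (f j)) < A_norm M d g + \<epsilon> / 2"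
    using g bdd_below_A_norm unfolding A_norm_def A_space_def by (subst (asm) cINF_less_iff) auto
  have fL: "f j e \<in> Lp P" if "e \<in> cube_nz d" for j e
    using f(1) that unfolding A_rep_def Lspace_eq_Lp by blast
  have w: "summable (\<lambda>j. A_weight M d (f j))" and sums: "\<And>x. (\<lambda>j. cubic_conv M d (f j) x) sums g x"
    using f(1) by (auto simp: A_rep_def)
  have R: "(\<lambda>j. A_weight M d (f j) + \<epsilon> / 2 * (1 / 2) ^ Suc j) sums ((\<Sum>j. A_weight M d (f j)) + \<epsilon> / 2)"
    by (intro sums_add sums_half_powers summable_sums w)
  have "A_bound (\<lambda>x. \<Sum>j. cubic_conv M d (f j) x) (\<Sum>j. A_weight M d (f j) + \<epsilon> / 2 * (1 / 2) ^ Suc j)"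
    using \<epsilon> by (intro A_bound_suminf A_bound_cubic_conv_Lp fL sums_summable[OF R]) auto
  then have "A_bound g ((\<Sum>j. A_weight M d (f j)) + \<epsilon> / 2)"
    by (simp only: sums_unique[OF sums, symmetric] sums_unique[OF R, symmetric])
  then show ?thesis
    using f(2) by (elim A_bound_mono) linarith
qed

lemma A_space_mult:
  assumes g: "g \<in> A_space M d" and h: "h \<in> A_space M d"
  shows "(\<lambda>x. g x * h x) \<in> A_space M d" and "A_norm M d (\<lambda>x. g x * h x) \<le> A_norm M d g * A_norm M d h"
proof -
  let ?\<phi> = "\<lambda>\<epsilon>. (A_norm M d g + \<epsilon>) * (A_norm M d h + \<epsilon>) + \<epsilon>"
  have bound: "A_bound (\<lambda>x. g x * h x) (?\<phi> \<epsilon>)" if "0 < \<epsilon>" for \<epsilon>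
    using that by (intro A_bound_mult A_space_imp_A_bound g h)
  show "(\<lambda>x. g x * h x) \<in> A_space M d"
    by (rule A_bound_imp_A_space(1)[OF bound[OF zero_less_one]])
  have "(?\<phi> \<longlongrightarrow> (A_norm M d g + 0) * (A_norm M d h + 0) + 0) (at_right 0)"
    by (intro tendsto_intros)
  moreover have "\<forall>\<^sub>F \<epsilon> in at_right 0. A_norm M d (\<lambda>x. g x * h x) \<le> ?\<phi> \<epsilon>"
    by (rule eventually_mono[OF eventually_at_right_less]) (rule A_bound_imp_A_space(2)[OF bound])
  ultimately show "A_norm M d (\<lambda>x. g x * h x) \<le> A_norm M d g * A_norm M d h"
    using tendsto_lowerbound[of ?\<phi> _ "at_right 0"] by simp
qed

end

theorem theorem4p7:
  fixes M :: "'a::{topological_ab_group_add, t2_space} measure" and d :: nat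
  assumes "compact (UNIV :: 'a set)"
    and "haar_probability M"
    and "d \<ge> 1"
  shows "\<forall>g\<in>A_space M d. \<forall>g'\<in>A_space M d.
           (\<lambda>x. g x * g' x) \<in> A_space M d \<and>
           A_norm M d (\<lambda>x. g x * g' x) \<le> A_norm M d g * A_norm M d g'"
proof -
  interpret prob_space M
    using assms(2) by (simp add: haar_probability_def)
  interpret cubic_algebra M d
    by unfold_locales (use assms in auto)
  show ?thesis
    using A_space_mult by blast
qed

end
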